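(* The hypotheses $b\in BMO^1_\alpha(\mathbb B_n,\mathcal L(\ell^2))$ and $\widetilde b\in L^\infty(\mathbb B_n,\mathcal L(\ell^2))$ do not imply that $T_b\in\mathcal T_{L^\infty_{fin}}$; that is, there exists $b\in BMO^1_\alpha(\mathbb B_n,\mathcal L(\ell^2))$ with $\widetilde b\in L^\infty(\mathbb B_n,\mathcal L(\ell^2))$ such that $T_b\notin\mathcal T_{L^\infty_{fin}}$.
   Context: Fix an integer $n\ge 1$ and a real $\alpha>-1$. $\mathbb B_n$ is the open unit ball of $\mathbb C^n$, $\langle z,w\rangle=\sum_k z_k\overline{w_k}$, and $d\nu_\alpha(z)=c_\alpha(1-|z|^2)^\alpha d\nu(z)$, where $\nu$ is Lebesgue measure and $c_\alpha$ is the constant making $\nu_\alpha$ a probability measure on $\mathbb B_n$. For a complex Banach space $E$ and $1\le p<\infty$, $L^p_\alpha(\mathbb B_n,E)$ is the Bochner–Lebesgue space of measurable $f:\mathbb B_n\to E$ with $\|f\|^p=\int_{\mathbb B_n}\|f(z)\|_E^p\,d\nu_\alpha(z)<\infty$; $L^\infty(\mathbb B_n,E)$ is the space of essentially bounded measurable functions; $A^p_\alpha(\mathbb B_n,E)$ is the subspace of holomorphic functions in $L^p_\alpha(\mathbb B_n,E)$; $H^\infty(\mathbb B_n,E)$ is the space of bounded holomorphic functions, which is dense in $A^2_\alpha(\mathbb B_n,E)$. $\mathcal L(E,F)$ denotes bounded linear operators and $\mathcal L(E)=\mathcal L(E,E)$. Kernels: $K^\alpha_z(w)=(1-\langle w,z\rangle)^{-(n+1+\alpha)}$,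 $k^\alpha_z(w)=(1-|z|^2)^{(n+1+\alpha)/2}(1-\langle w,z\rangle)^{-(n+1+\alpha)}$. For $a\in\mathbb B_n\setminus\{0\}$, $\varphi_a(z)=\dfrac{a-P_a(z)-\sqrt{1-|a|^2}\,Q_a(z)}{1-\langle z,a\rangle}$ with $P_a(z)=\frac{\langle z,a\rangle}{|a|^2}a$, $Q_a=I-P_a$; $\varphi_0(z)=-z$. For $b\in L^1_\alpha(\mathbb B_n,E)$ the Berezin transform is $\widetilde b(z)=\int_{\mathbb B_n}|k^\alpha_z(w)|^2b(w)\,d\nu_\alpha(w)$, and $b\in BMO^1_\alpha(\mathbb B_n,E)$ if $\sup_{z\in\mathbb B_n}\|b\circ\varphi_z-\widetilde b(z)\|_{L^1_\alpha(\mathbb B_n,E)}<\infty$. For $b\in L^1_\alpha(\mathbb B_n,\mathcal L(E,F))$ the Toeplitz operator $T_b$ is densely defined on $A^2_\alpha(\mathbb B_n,E)$ by $T_bf(z)=\int_{\mathbb B_n}b(w)(f(w))\overline{K^\alpha_z(w)}\,d\nu_\alpha(w)$, $f\in H^\infty(\mathbb B_n,E)$. It is known that if $b\in BMO^1_\alpha(\mathbb B_n,\mathcal L(E,F))$ and $\widetilde b\in L^\infty(\mathbb B_n,\mathcal L(E,F))$, then $T_b$ extends to a bounded operator $A^2_\alpha(\mathbb B_n,E)\to A^2_\alpha(\mathbb B_n,F)$, still denoted $T_b$. Fix an orthonormal basis $\{e_j\}_{j\ge1}$ of $\ell^2$. A function $u:\mathbb B_n\to\mathcal L(\ell^2)$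 is in $L^\infty_{fin}$ if $\langle u(\cdot)e_j,e_k\rangle_{\ell^2}$ is non-zero for only finitely many pairs $(j,k)$ and each function $z\mapsto\langle u(z)e_j,e_k\rangle_{\ell^2}$ is bounded (and measurable) on $\mathbb B_n$. The Toeplitz algebra $\mathcal T_{L^\infty_{fin}}$ is the operator-norm closure in $\mathcal L(A^2_\alpha(\mathbb B_n,\ell^2))$ of the set of operators $\sum_{l=1}^L\prod_{j=1}^JT_{u_{j,l}}$ with $u_{j,l}\in L^\infty_{fin}$ and $J,L<\infty$. *)

theory Defs
  imports "HOL-Analysis.Analysis"
begin

section \<open>The complex Hilbert space of square-summable sequences\<close>

typedef ell2 = "{x :: nat \<Rightarrow> complex. summable (\<lambda>i. (cmod (x i))\<^sup>2)}"
  morphisms coord Abs_ell2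
  by (rule exI[of _ "\<lambda>_. 0"]) simp

setup_lifting type_definition_ell2

lemma ell2_summable: "summable (\<lambda>i. (cmod (coord x i))\<^sup>2)"
  using coord by blast

lemma ell2_summable_add:
  fixes x y :: "nat \<Rightarrow> complex"
  assumes "summable (\<lambda>i. (cmod (x i))\<^sup>2)" "summable (\<lambda>i. (cmod (y i))\<^sup>2)"
  shows "summable (\<lambda>i. (cmod (x i + y i))\<^sup>2)"
proof (rule summable_comparison_test')
  show "summable (\<lambda>i. 2 * (cmod (x i))\<^sup>2 + 2 * (cmod (y i))\<^sup>2)"
    using assms by (intro summable_add summable_mult)
  fix i
  have "(cmod (x i + y i))\<^sup>2 \<le> (cmod (x i) + cmod (y i))\<^sup>2"
    by (simp add: norm_triangle_ineq power_mono)
  also have "\<dots> \<le> 2 * (cmod (x i))\<^sup>2 + 2 * (cmod (y i))\<^sup>2"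
    using sum_squares_bound[of "cmod (x i)" "cmod (y i)"] by (simp add: power2_sum)
  finally show "norm ((cmod (x i + y i))\<^sup>2) \<le> 2 * (cmod (x i))\<^sup>2 + 2 * (cmod (y i))\<^sup>2"
    by simp
qed

lemma ell2_summable_mult:
  fixes x y :: "nat \<Rightarrow> complex"
  assumes "summable (\<lambda>i. (cmod (x i))\<^sup>2)" "summable (\<lambda>i. (cmod (y i))\<^sup>2)"
  shows "summable (\<lambda>i. cmod (x i) * cmod (y i))"
proof (rule summable_comparison_test')
  show "summable (\<lambda>i. (cmod (x i))\<^sup>2 + (cmod (y i))\<^sup>2)"
    using assms by (rule summable_add)
  show "norm (cmod (x i) * cmod (y i)) \<le> (cmod (x i))\<^sup>2 + (cmod (y i))\<^sup>2" for i
  proof -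
    have "0 \<le> cmod (x i) * cmod (y i)" by simp
    then have "cmod (x i) * cmod (y i) \<le> (cmod (x i))\<^sup>2 + (cmod (y i))\<^sup>2"
      using sum_squares_bound[of "cmod (x i)" "cmod (y i)"] by linarith
    then show ?thesis by simp
  qed
qed

lift_definition scaleC_ell2 :: "complex \<Rightarrow> ell2 \<Rightarrow> ell2" (infixr \<open>*\<^sub>C\<close> 75)
  is "\<lambda>c x i. c * x i"
  by (simp add: norm_mult power_mult_distrib summable_mult)

definition cinner_ell2 :: "ell2 \<Rightarrow> ell2 \<Rightarrow> complex" where
  "cinner_ell2 x y = (\<Sum>i. coord x i * cnj (coord y i))"

instantiation ell2 :: real_inner
begin

lift_definition zero_ell2 :: ell2 is "\<lambda>_. 0" by simp

lift_definition plus_ell2 :: "ell2 \<Rightarrow> ell2 \<Rightarrow> ell2" is "\<lambda>x y i. x i + y i"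
  by (rule ell2_summable_add)

lift_definition uminus_ell2 :: "ell2 \<Rightarrow> ell2" is "\<lambda>x i. - x i" by simp

lift_definition minus_ell2 :: "ell2 \<Rightarrow> ell2 \<Rightarrow> ell2" is "\<lambda>x y i. x i - y i"
  using ell2_summable_add[where y = "\<lambda>i. - y i" for y] by simp

lift_definition scaleR_ell2 :: "real \<Rightarrow> ell2 \<Rightarrow> ell2" is "\<lambda>r x i. r *\<^sub>R x i"
  by (simp add: power_mult_distrib summable_mult)

definition inner_ell2 :: "ell2 \<Rightarrow> ell2 \<Rightarrow> real" where
  "inner_ell2 x y = (\<Sum>i. coord x i \<bullet> coord y i)"

definition norm_ell2 :: "ell2 \<Rightarrow> real" where
  "norm_ell2 x = sqrt (\<Sum>i. (cmod (coord x i))\<^sup>2)"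

definition sgn_ell2 :: "ell2 \<Rightarrow> ell2" where
  "sgn_ell2 x = inverse (norm x) *\<^sub>R x"

definition dist_ell2 :: "ell2 \<Rightarrow> ell2 \<Rightarrow> real" where
  "dist_ell2 x y = norm (x - y)"

definition [code del]:
  "(uniformity :: (ell2 \<times> ell2) filter) = (INF e\<in>{0 <..}. principal {(x, y). dist x y < e})"

definition open_ell2 :: "ell2 set \<Rightarrow> bool" where
  "open_ell2 U \<longleftrightarrow> (\<forall>x\<in>U. eventually (\<lambda>(x', y). x' = x \<longrightarrow> y \<in> U) uniformity)"

lemma summable_inner_ell2: "summable (\<lambda>i. coord x i \<bullet> coord y i)"
proof (rule summable_comparison_test')
  show "summable (\<lambda>i. cmod (coord x i) * cmod (coord y i))"
    by (rule ell2_summable_mult[OF ell2_summable ell2_summable])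
qed (simp add: Cauchy_Schwarz_ineq2)

instance
proof
  fix x y z :: ell2 and a b :: real
  show "x + y + z = x + (y + z)" "x + y = y + x" "0 + x = x" "- x + x = 0" "x - y = x + - y"
    by (transfer; simp add: algebra_simps)+
  show "a *\<^sub>R (x + y) = a *\<^sub>R x + a *\<^sub>R y" "(a + b) *\<^sub>R x = a *\<^sub>R x + b *\<^sub>R x"
    "a *\<^sub>R b *\<^sub>R x = (a * b) *\<^sub>R x" "1 *\<^sub>R x = x"
    by (transfer; simp add: algebra_simps)+
  show "dist x y = norm (x - y)" by (rule dist_ell2_def)
  show "sgn x = inverse (norm x) *\<^sub>R x" by (rule sgn_ell2_def)
  show "uniformity = (INF e\<in>{0 <..}. principal {(x, y :: ell2). dist x y < e})"
    by (rule uniformity_ell2_def)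
  show "open U \<longleftrightarrow> (\<forall>x\<in>U. eventually (\<lambda>(x', y). x' = x \<longrightarrow> y \<in> U) uniformity)" for U :: "ell2 set"
    by (rule open_ell2_def)
  show "x \<bullet> y = y \<bullet> x" by (simp add: inner_ell2_def inner_commute)
  show "(x + y) \<bullet> z = x \<bullet> z + y \<bullet> z"
    by (simp add: inner_ell2_def plus_ell2.rep_eq inner_add_left suminf_add summable_inner_ell2)
  show "(a *\<^sub>R x) \<bullet> y = a * (x \<bullet> y)"
    by (simp add: inner_ell2_def scaleR_ell2.rep_eq suminf_mult[OF summable_inner_ell2])
  show "0 \<le> x \<bullet> x"
    by (simp add: inner_ell2_def suminf_nonneg summable_inner_ell2)
  have "(x \<bullet> x = 0) = (\<forall>i. coord x i \<bullet> coord x i = 0)"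
    unfolding inner_ell2_def by (rule suminf_eq_zero_iff[OF summable_inner_ell2]) simp
  also have "\<dots> = (x = 0)"
    by (simp add: coord_inject[symmetric] zero_ell2.rep_eq fun_eq_iff)
  finally show "(x \<bullet> x = 0) = (x = 0)" .
  show "norm x = sqrt (x \<bullet> x)"
    by (simp add: norm_ell2_def inner_ell2_def power2_norm_eq_inner)
qed

end

lemma norm_ell2_power2: "(norm x)\<^sup>2 = (\<Sum>i. (cmod (coord x i))\<^sup>2)"
  by (simp add: norm_ell2_def suminf_nonneg ell2_summable)

lemma sum_coord_le_norm: "(\<Sum>i<N. (cmod (coord x i))\<^sup>2) \<le> (norm x)\<^sup>2"
  unfolding norm_ell2_power2 by (rule sum_le_suminf[OF ell2_summable]) auto

lemma cmod_coord_le_norm: "cmod (coord x i) \<le> norm x"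
proof (rule power2_le_imp_le)
  have "(cmod (coord x i))\<^sup>2 \<le> (\<Sum>j<Suc i. (cmod (coord x j))\<^sup>2)"
    by (rule member_le_sum) auto
  also have "\<dots> \<le> (norm x)\<^sup>2" by (rule sum_coord_le_norm)
  finally show "(cmod (coord x i))\<^sup>2 \<le> (norm x)\<^sup>2" .
qed simp

instance ell2 :: banach
proof
  fix X :: "nat \<Rightarrow> ell2"
  assume X: "Cauchy X"
  have "Cauchy (\<lambda>n. coord (X n) i)" for i
  proof (rule metric_CauchyI)
    fix e :: real assume "0 < e"
    then obtain M where M: "\<And>m n. m \<ge> M \<Longrightarrow> n \<ge> M \<Longrightarrow> dist (X m) (X n) < e"
      using metric_CauchyD[OF X] by blast
    have "dist (coord (X m) i) (coord (X n) i) < e" if "m \<ge> M" "n \<ge> M" for m n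
      using M[OF that] cmod_coord_le_norm[of "X m - X n" i]
      by (simp add: dist_norm minus_ell2.rep_eq)
    then show "\<exists>M. \<forall>m\<ge>M. \<forall>n\<ge>M. dist (coord (X m) i) (coord (X n) i) < e" by blast
  qed
  then have "\<forall>i. \<exists>l. (\<lambda>n. coord (X n) i) \<longlonglongrightarrow> l"
    by (simp add: Cauchy_convergent_iff convergent_def)
  then obtain l where l: "\<And>i. (\<lambda>n. coord (X n) i) \<longlonglongrightarrow> l i" by metis
  have tail: "(\<Sum>i<N. (cmod (coord (X m) i - l i))\<^sup>2) \<le> e\<^sup>2"
    if "\<And>n. n \<ge> M \<Longrightarrow> norm (X m - X n) \<le> e" "0 \<le> e" for M m N e
  proof (rule tendsto_upperbound)
    show "(\<lambda>n. \<Sum>i<N. (cmod (coord (X m) i - coord (X n) i))\<^sup>2)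
        \<longlonglongrightarrow> (\<Sum>i<N. (cmod (coord (X m) i - l i))\<^sup>2)"
      by (intro tendsto_intros l)
    show "\<forall>\<^sub>F n in sequentially. (\<Sum>i<N. (cmod (coord (X m) i - coord (X n) i))\<^sup>2) \<le> e\<^sup>2"
      using eventually_ge_at_top[of M]
    proof eventually_elim
      case (elim n)
      have "(\<Sum>i<N. (cmod (coord (X m) i - coord (X n) i))\<^sup>2) \<le> (norm (X m - X n))\<^sup>2"
        using sum_coord_le_norm[where x = "X m - X n"] by (simp add: minus_ell2.rep_eq)
      also have "\<dots> \<le> e\<^sup>2" using that(1)[OF elim] by (simp add: power_mono)
      finally show ?case .
    qed
  qed simp
  have summ: "summable (\<lambda>i. (cmod (coord (X m) i - l i))\<^sup>2)"
    if "\<And>n. n \<ge> M \<Longrightarrow> norm (X m - X n) \<le> e" "0 \<le> e" for M m e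
  proof (rule bounded_imp_summable[where B = "e\<^sup>2"])
    show "(\<Sum>i\<le>n. (cmod (coord (X m) i - l i))\<^sup>2) \<le> e\<^sup>2" for n
      using tail[OF that, where N = "Suc n"] by (simp only: lessThan_Suc_atMost)
  qed simp
  obtain M1 where M1: "\<And>m n. m \<ge> M1 \<Longrightarrow> n \<ge> M1 \<Longrightarrow> dist (X m) (X n) < 1"
    using metric_CauchyD[OF X, of 1] by auto
  have "summable (\<lambda>i. (cmod (coord (X M1) i - l i))\<^sup>2)"
    by (rule summ[of M1 _ 1]) (use M1[of M1] in \<open>auto simp: dist_norm intro: less_imp_le\<close>)
  then have "summable (\<lambda>i. (cmod (coord (X M1) i + - (coord (X M1) i - l i)))\<^sup>2)"
    by (intro ell2_summable_add ell2_summable) (simp add: norm_minus_commute)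
  then have lsum: "summable (\<lambda>i. (cmod (l i))\<^sup>2)" by simp
  define L where "L = Abs_ell2 l"
  have L: "coord L = l" unfolding L_def using lsum by (simp add: Abs_ell2_inverse)
  have "X \<longlonglongrightarrow> L"
  proof (rule LIMSEQ_I)
    fix r :: real assume r: "0 < r"
    obtain M where M: "\<And>m n. m \<ge> M \<Longrightarrow> n \<ge> M \<Longrightarrow> dist (X m) (X n) < r / 2"
      using metric_CauchyD[OF X, of "r / 2"] r by auto
    have "norm (X m - L) < r" if m: "m \<ge> M" for m
    proof -
      have le: "norm (X m - X n) \<le> r / 2" if "n \<ge> M" for n
        using M[OF m that] by (simp add: dist_norm less_imp_le)
      have "(norm (X m - L))\<^sup>2 = (\<Sum>i. (cmod (coord (X m) i - l i))\<^sup>2)"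
        by (simp add: norm_ell2_power2 minus_ell2.rep_eq L)
      also have "\<dots> \<le> (r / 2)\<^sup>2"
        by (rule suminf_le_const[OF summ[OF le]]) (use tail[OF le] r in auto)
      finally have "norm (X m - L) \<le> r / 2"
        using r by (intro power2_le_imp_le[of "norm (X m - L)"]) auto
      then show ?thesis using r by simp
    qed
    then show "\<exists>no. \<forall>n\<ge>no. norm (X n - L) < r" by blast
  qed
  then show "convergent X" by (rule convergentI)
qed

lemma ell2_countable_dense:
  "\<exists>D :: ell2 set. countable D \<and> (\<forall>x. \<forall>e>0. \<exists>d\<in>D. dist x d < e)"
proof -
  define g :: "(rat \<times> rat) list \<Rightarrow> nat \<Rightarrow> complex" where
    "g xs i = (if i < length xs
       then Complex (real_of_rat (fst (xs ! i))) (real_of_rat (snd (xs ! i))) else 0)" for xs i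
  have gs: "summable (\<lambda>i. (cmod (g xs i))\<^sup>2)" for xs
    by (rule summable_finite[of "{..<length xs}"]) (auto simp: g_def)
  have cg: "coord (Abs_ell2 (g xs)) = g xs" for xs
    using gs by (simp add: Abs_ell2_inverse)
  have approx: "\<exists>q::rat \<times> rat. cmod (z - Complex (real_of_rat (fst q)) (real_of_rat (snd q))) < d"
    if d: "0 < d" for z d
  proof -
    obtain a where a: "Re z < of_rat a" "of_rat a < Re z + d / 2"
      using of_rat_dense[of "Re z" "Re z + d / 2"] d by auto
    obtain b where b: "Im z < of_rat b" "of_rat b < Im z + d / 2"
      using of_rat_dense[of "Im z" "Im z + d / 2"] d by auto
    have "cmod (z - Complex (of_rat a) (of_rat b)) \<le> \<bar>Re z - of_rat a\<bar> + \<bar>Im z - of_rat b\<bar>"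
      using cmod_le[of "z - Complex (of_rat a) (of_rat b)"] by simp
    also have "\<dots> < d" using a b by simp
    finally show ?thesis by (intro exI[of _ "(a, b)"]) simp
  qed
  have dense: "\<exists>xs. dist x (Abs_ell2 (g xs)) < e" if e: "e > 0" for x e
  proof -
    have "(\<lambda>N. \<Sum>i<N. (cmod (coord x i))\<^sup>2) \<longlonglongrightarrow> (\<Sum>i. (cmod (coord x i))\<^sup>2)"
      by (rule summable_LIMSEQ[OF ell2_summable])
    moreover have "0 < e\<^sup>2 / 2" using e by simp
    ultimately obtain N where N0:
        "norm ((\<Sum>i<N. (cmod (coord x i))\<^sup>2) - (\<Sum>i. (cmod (coord x i))\<^sup>2)) < e\<^sup>2 / 2"
      using LIMSEQ_D by blast
    then have N: "(\<Sum>i. (cmod (coord x (i + N)))\<^sup>2) < e\<^sup>2 / 2"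
      using suminf_split_initial_segment[OF ell2_summable, of x N]
      by (simp add: abs_less_iff)
    define d where "d = e / (2 * sqrt (real N + 1))"
    have d: "d > 0" using e by (simp add: d_def)
    have d2: "d\<^sup>2 * (real N + 1) = e\<^sup>2 / 4"
      by (simp add: d_def power_divide power_mult_distrib) (simp add: field_simps)
    obtain q where q: "\<And>i. cmod (coord x i
        - Complex (real_of_rat (fst (q i))) (real_of_rat (snd (q i)))) < d"
      using choice[OF allI, OF approx[OF d]] by blast
    define xs where "xs = map q [0..<N]"
    have gx: "g xs i = (if i < N then Complex (real_of_rat (fst (q i))) (real_of_rat (snd (q i))) else 0)" for i
      by (simp add: g_def xs_def)
    have "(norm (x - Abs_ell2 (g xs)))\<^sup>2
        = (\<Sum>i. (cmod (coord (x - Abs_ell2 (g xs)) (i + N)))\<^sup>2)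
          + (\<Sum>i<N. (cmod (coord (x - Abs_ell2 (g xs)) i))\<^sup>2)"
      unfolding norm_ell2_power2 by (rule suminf_split_initial_segment[OF ell2_summable])
    also have "(\<Sum>i. (cmod (coord (x - Abs_ell2 (g xs)) (i + N)))\<^sup>2)
        = (\<Sum>i. (cmod (coord x (i + N)))\<^sup>2)"
      by (simp add: minus_ell2.rep_eq cg gx)
    also have "(\<Sum>i<N. (cmod (coord (x - Abs_ell2 (g xs)) i))\<^sup>2) \<le> (\<Sum>i<N. d\<^sup>2)"
      by (rule sum_mono) (auto simp: minus_ell2.rep_eq cg gx intro!: power_mono less_imp_le[OF q])
    also have "(\<Sum>i<N. d\<^sup>2) \<le> e\<^sup>2 / 4"
      using d2 by (simp add: algebra_simps flip: d2)
    finally have "(norm (x - Abs_ell2 (g xs)))\<^sup>2 \<le> (\<Sum>i. (cmod (coord x (i + N)))\<^sup>2) + e\<^sup>2 / 4"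
      by simp
    moreover have "0 < e\<^sup>2" using e by simp
    ultimately have "(norm (x - Abs_ell2 (g xs)))\<^sup>2 < e\<^sup>2"
      using N by linarith
    then have "norm (x - Abs_ell2 (g xs)) < e"
      using e by (simp add: power_less_imp_less_base)
    then show ?thesis by (auto simp: dist_norm)
  qed
  show ?thesis
    by (rule exI[of _ "range (\<lambda>xs. Abs_ell2 (g xs))"]) (use dense in auto)
qed

instance ell2 :: second_countable_topology
proof
  obtain D :: "ell2 set" where D: "countable D" "\<And>x e. e > 0 \<Longrightarrow> \<exists>d\<in>D. dist x d < e"
    using ell2_countable_dense by blast
  define B where "B = (\<lambda>(d, n). ball d (1 / Suc n)) ` (D \<times> (UNIV :: nat set))"
  have "topological_basis B"
  proof (rule topological_basisI)
    show "open b" if "b \<in> B" for b using that by (auto simp: B_def)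
    fix U and x :: ell2 assume U: "open U" "x \<in> U"
    then obtain e where e: "e > 0" "ball x e \<subseteq> U" by (meson openE)
    obtain n where n: "1 / real (Suc n) < e / 2"
      using e(1) by (meson half_gt_zero nat_approx_posE)
    obtain d where d: "d \<in> D" "dist x d < 1 / real (Suc n)"
      using D(2)[of "1 / real (Suc n)" x] by auto
    have "y \<in> ball x e" if "dist d y < 1 / real (Suc n)" for y
      using dist_triangle[of x y d] d(2) n that by simp
    then have "ball d (1 / Suc n) \<subseteq> U" using e(2) by auto
    moreover have "x \<in> ball d (1 / Suc n)" using d(2) by (simp add: dist_commute)
    ultimately show "\<exists>B'\<in>B. x \<in> B' \<and> B' \<subseteq> U" using d(1) by (force simp: B_def)
  qed
  moreover have "countable B" unfolding B_def using D(1) by auto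
  ultimately show "\<exists>B :: ell2 set set. countable B \<and> open = generate_topology B"
    using topological_basis_imp_subbasis by blast
qed

definition ell2_orthonormal_basis :: "(nat \<Rightarrow> ell2) \<Rightarrow> bool" where
  "ell2_orthonormal_basis e \<longleftrightarrow>
     (\<forall>j k. cinner_ell2 (e j) (e k) = (if j = k then 1 else 0)) \<and>
     closure {\<Sum>j<N. c j *\<^sub>C e j | (N :: nat) (c :: nat \<Rightarrow> complex). True} = UNIV"

text \<open>Elements of \<^typ>\<open>ell2 \<Rightarrow>\<^sub>L ell2\<close> are only real-linear; the complex-linear ones form
  the closed subspace of bounded operators on the complex space.\<close>

definition L_ell2 :: "(ell2 \<Rightarrow>\<^sub>L ell2) set" where
  "L_ell2 = {A. \<forall>c x. blinfun_apply A (c *\<^sub>C x) = c *\<^sub>C blinfun_apply A x}"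


section \<open>Bochner integration in non-separable spaces\<close>

text \<open>The library's Bochner integral requires a second countable codomain, which excludes the
  bounded operators on an infinite-dimensional Hilbert space with the operator norm. The
  following repeats the library's definition with strong measurability in place of Borel
  measurability. It is used only for complete measures, where almost everywhere limits of simple
  functions are measurable.\<close>

definition strongly_measurable :: "'a measure \<Rightarrow> ('a \<Rightarrow> 'e::real_normed_vector) \<Rightarrow> bool" where
  "strongly_measurable M f \<longleftrightarrow>
     (\<exists>s. (\<forall>i::nat. simple_function M (s i)) \<and> (AE x in M. (\<lambda>i. s i x) \<longlonglongrightarrow> f x))"

definition has_strong_integral ::
    "'a measure \<Rightarrow> ('a \<Rightarrow> 'e::real_normed_vector) \<Rightarrow> 'e \<Rightarrow> bool" where
  "has_strong_integral M f I \<longleftrightarrow>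
     strongly_measurable M f \<and>
     (\<exists>s. (\<forall>i::nat. Bochner_Integration.simple_bochner_integrable M (s i)) \<and>
          (\<lambda>i. \<integral>\<^sup>+x. ennreal (norm (f x - s i x)) \<partial>M) \<longlonglongrightarrow> 0 \<and>
          (\<lambda>i. Bochner_Integration.simple_bochner_integral M (s i)) \<longlonglongrightarrow> I)"

definition strong_integral :: "'a measure \<Rightarrow> ('a \<Rightarrow> 'e::real_normed_vector) \<Rightarrow> 'e" where
  "strong_integral M f =
     (if \<exists>I. has_strong_integral M f I then THE I. has_strong_integral M f I else 0)"


section \<open>Weighted measures, kernels and automorphisms of the unit ball\<close>

definition hdot :: "complex ^ 'n \<Rightarrow> complex ^ 'n \<Rightarrow> complex" where
  "hdot z w = (\<Sum>k\<in>UNIV. z $ k * cnj (w $ k))"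

definition nu :: "real \<Rightarrow> (complex ^ 'n) measure" where
  "nu \<alpha> = density (lebesgue_on (ball 0 1)) (\<lambda>z. ennreal ((1 - (norm z)\<^sup>2) powr \<alpha> /
     (LINT w:ball 0 1|(lebesgue :: (complex ^ 'n) measure). (1 - (norm w)\<^sup>2) powr \<alpha>)))"

text \<open>The principal power is the intended branch: \<^term>\<open>1 - hdot w z\<close> has positive real part.\<close>

definition kernelK :: "real \<Rightarrow> complex ^ 'n \<Rightarrow> complex ^ 'n \<Rightarrow> complex" where
  "kernelK \<alpha> z w = (1 - hdot w z) powr of_real (- (real CARD('n) + 1 + \<alpha>))"

definition kernelk :: "real \<Rightarrow> complex ^ 'n \<Rightarrow> complex ^ 'n \<Rightarrow> complex" where
  "kernelk \<alpha> z w =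
     of_real ((1 - (norm z)\<^sup>2) powr ((real CARD('n) + 1 + \<alpha>) / 2)) *
     (1 - hdot w z) powr of_real (- (real CARD('n) + 1 + \<alpha>))"

definition line_proj :: "complex ^ 'n \<Rightarrow> complex ^ 'n \<Rightarrow> complex ^ 'n" where
  "line_proj a z = (hdot z a / of_real ((norm a)\<^sup>2)) *s a"

definition ball_aut :: "complex ^ 'n \<Rightarrow> complex ^ 'n \<Rightarrow> complex ^ 'n" where
  "ball_aut a z = (if a = 0 then - z else
     (1 / (1 - hdot z a)) *s (a - line_proj a z - sqrt (1 - (norm a)\<^sup>2) *\<^sub>R (z - line_proj a z)))"


section \<open>Function spaces\<close>

text \<open>Functions on the ball are represented by total functions whose values outside the ball are
  irrelevant, since \<^term>\<open>space (nu \<alpha>)\<close> is the ball.\<close>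

definition Lp_space :: "real \<Rightarrow> real \<Rightarrow> (complex ^ 'n \<Rightarrow> 'e::real_normed_vector) set" where
  "Lp_space \<alpha> p = {f. strongly_measurable (nu \<alpha>) f \<and>
     (\<integral>\<^sup>+z. ennreal (norm (f z) powr p) \<partial>nu \<alpha>) < \<infinity>}"

definition Lp_norm :: "real \<Rightarrow> real \<Rightarrow> (complex ^ 'n \<Rightarrow> 'e::real_normed_vector) \<Rightarrow> real" where
  "Lp_norm \<alpha> p f = (LINT z|nu \<alpha>. norm (f z) powr p) powr (1 / p)"

definition Linf_space :: "real \<Rightarrow> (complex ^ 'n \<Rightarrow> 'e::real_normed_vector) set" where
  "Linf_space \<alpha> = {f. strongly_measurable (nu \<alpha>) f \<and> (\<exists>C. AE z in nu \<alpha>. norm (f z) \<le> C)}"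

definition berezin ::
    "real \<Rightarrow> (complex ^ 'n \<Rightarrow> 'e::real_normed_vector) \<Rightarrow> complex ^ 'n \<Rightarrow> 'e" where
  "berezin \<alpha> b z = strong_integral (nu \<alpha>) (\<lambda>w. (cmod (kernelk \<alpha> z w))\<^sup>2 *\<^sub>R b w)"

definition BMO1 :: "real \<Rightarrow> (complex ^ 'n \<Rightarrow> 'e::real_normed_vector) set" where
  "BMO1 \<alpha> = {b \<in> Lp_space \<alpha> 1.
     (SUP z\<in>ball 0 1. \<integral>\<^sup>+w. ennreal (norm (b (ball_aut z w) - berezin \<alpha> b z)) \<partial>nu \<alpha>) < \<infinity>}"

definition holomorphic_ball :: "(complex ^ 'n \<Rightarrow> ell2) \<Rightarrow> bool" where
  "holomorphic_ball f \<longleftrightarrow> (\<forall>z\<in>ball 0 1. \<exists>f'. (f has_derivative f') (at z) \<and>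
     (\<forall>c h. f' (c *s h) = c *\<^sub>C f' h))"

text \<open>Elements of the two spaces of holomorphic functions are normalised to vanish outside the
  ball, so that equality of functions on the ball is equality in HOL.\<close>

definition bergman_space :: "real \<Rightarrow> (complex ^ 'n \<Rightarrow> ell2) set" where
  "bergman_space \<alpha> = {f \<in> Lp_space \<alpha> 2. holomorphic_ball f \<and> (\<forall>z. z \<notin> ball 0 1 \<longrightarrow> f z = 0)}"

definition Hinf_space :: "(complex ^ 'n \<Rightarrow> ell2) set" where
  "Hinf_space = {f. holomorphic_ball f \<and> bounded (f ` ball 0 1) \<and>
     (\<forall>z. z \<notin> ball 0 1 \<longrightarrow> f z = 0)}"


section \<open>Operators on the Bergman space\<close>

type_synonym 'n ell2_fun = "complex ^ 'n \<Rightarrow> ell2"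

definition bergman_op :: "real \<Rightarrow> ('n::finite ell2_fun \<Rightarrow> 'n ell2_fun) \<Rightarrow> bool" where
  "bergman_op \<alpha> T \<longleftrightarrow>
     (\<forall>f\<in>bergman_space \<alpha>. T f \<in> bergman_space \<alpha>) \<and>
     (\<forall>f\<in>bergman_space \<alpha>. \<forall>g\<in>bergman_space \<alpha>. T (\<lambda>z. f z + g z) = (\<lambda>z. T f z + T g z)) \<and>
     (\<forall>c. \<forall>f\<in>bergman_space \<alpha>. T (\<lambda>z. c *\<^sub>C f z) = (\<lambda>z. c *\<^sub>C T f z)) \<and>
     (\<exists>C. \<forall>f\<in>bergman_space \<alpha>. Lp_norm \<alpha> 2 (T f) \<le> C * Lp_norm \<alpha> 2 f)"

definition bergman_op_norm :: "real \<Rightarrow> ('n::finite ell2_fun \<Rightarrow> 'n ell2_fun) \<Rightarrow> real" where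
  "bergman_op_norm \<alpha> T = (SUP f\<in>{f \<in> bergman_space \<alpha>. Lp_norm \<alpha> 2 f \<le> 1}. Lp_norm \<alpha> 2 (T f))"

definition toeplitz_fun ::
    "real \<Rightarrow> (complex ^ 'n \<Rightarrow> ell2 \<Rightarrow>\<^sub>L ell2) \<Rightarrow> 'n::finite ell2_fun \<Rightarrow> 'n ell2_fun" where
  "toeplitz_fun \<alpha> b f z = (if z \<in> ball 0 1
     then LINT w|nu \<alpha>. cnj (kernelK \<alpha> z w) *\<^sub>C blinfun_apply (b w) (f w) else 0)"

text \<open>\<^term>\<open>T\<close> is the bounded operator on the Bergman space extending the densely defined
  Toeplitz operator with symbol \<^term>\<open>b\<close>; it is determined on the Bergman space by \<^term>\<open>b\<close>.\<close>

definition is_toeplitz_op ::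
    "real \<Rightarrow> (complex ^ 'n \<Rightarrow> ell2 \<Rightarrow>\<^sub>L ell2) \<Rightarrow> ('n::finite ell2_fun \<Rightarrow> 'n ell2_fun) \<Rightarrow> bool" where
  "is_toeplitz_op \<alpha> b T \<longleftrightarrow> bergman_op \<alpha> T \<and> (\<forall>f\<in>Hinf_space. T f = toeplitz_fun \<alpha> b f)"

definition Linf_fin :: "(nat \<Rightarrow> ell2) \<Rightarrow> (complex ^ 'n \<Rightarrow> ell2 \<Rightarrow>\<^sub>L ell2) set" where
  "Linf_fin e = {u. (\<forall>z\<in>ball 0 1. u z \<in> L_ell2) \<and>
     finite {(j, k). \<exists>z\<in>ball 0 1. cinner_ell2 (blinfun_apply (u z) (e j)) (e k) \<noteq> 0} \<and>
     (\<forall>j k. bounded ((\<lambda>z. cinner_ell2 (blinfun_apply (u z) (e j)) (e k)) ` ball 0 1) \<and>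
       (\<lambda>z. cinner_ell2 (blinfun_apply (u z) (e j)) (e k))
         \<in> borel_measurable (lebesgue_on (ball 0 1)))}"

definition op_prod :: "nat \<Rightarrow> (nat \<Rightarrow> 'n ell2_fun \<Rightarrow> 'n ell2_fun) \<Rightarrow> 'n::finite ell2_fun \<Rightarrow> 'n ell2_fun" where
  "op_prod J T = foldr (\<circ>) (map T [1..<Suc J]) id"

definition toeplitz_poly ::
    "real \<Rightarrow> (nat \<Rightarrow> ell2) \<Rightarrow> ('n::finite ell2_fun \<Rightarrow> 'n ell2_fun) set" where
  "toeplitz_poly \<alpha> e = {\<lambda>f z. \<Sum>l=1..L. op_prod J (\<lambda>j. T j l) f z | J (L :: nat) T.
     1 \<le> J \<and> 1 \<le> L \<and>
     (\<forall>j\<in>{1..J}. \<forall>l\<in>{1..L}. \<exists>u\<in>Linf_fin e. is_toeplitz_op \<alpha> u (T j l))}"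

definition toeplitz_algebra ::
    "real \<Rightarrow> (nat \<Rightarrow> ell2) \<Rightarrow> ('n::finite ell2_fun \<Rightarrow> 'n ell2_fun) set" where
  "toeplitz_algebra \<alpha> e = {T. bergman_op \<alpha> T \<and>
     (\<forall>\<epsilon>>0. \<exists>S\<in>toeplitz_poly \<alpha> e. bergman_op_norm \<alpha> (\<lambda>f z. T f z - S f z) < \<epsilon>)}"

end

(* Take for b the identity operator times the indicator function of the ball of radius 1/2.
   Since |<z,w>| < 1/2 on its support, all kernels are bounded there, so T_b is given by its
   integral formula on the whole Bergman space and b lies in BMO^1 with bounded Berezin transform.
   On the constant functions e_N one has T_b e_N = tau e_N with a scalar function tau that is
   nonzero and does not depend on N, whereas every finite sum of products of Toeplitz operators with
   symbols in L^infinity_fin annihilates the constant e_N for all large N. Hence T_b has distance at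
   least ||tau|| from all these operators. *)

theory Submission
  imports Defs
begin

text \<open>The constant symbol \<open>id_blinfun\<close> would be a counterexample too: by the
  reproducing formula its Toeplitz operator is the identity. Cutting it off replaces that formula,
  and all estimates near the sphere, by bounds uniform in z, because |1 - <z,w>| >= 1/2 on the
  support; any radius below 1 would serve. As the symbol is a scalar function times one fixed
  operator, its integrals reduce to scalar ones although its values lie in a non-separable operator
  space. An approximant annihilates e_N as soon as the rightmost factor of each of its finitely many
  products does; the other factors only have to preserve 0. The index N depends on the approximant,
  which is why a lower bound common to all N is required. Two points cost work beyond this: for -1 <
  alpha < 0 the weight is unbounded, so its integrability must be proved before \<open>nu\<close> is
  a probability measure; and the supremum defining an operator norm dominates its members only once
  the approximants are known to be bounded.\<close>

section \<open>The weighted measure on the ball\<close>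

text \<open>Bernoulli's inequality bounds 1 - (1 - t)^d linearly in t, with d the real dimension.
  Linear decay is exactly what balances a weight of exponent above -1.\<close>

lemma emeasure_spherical_shell_le:
  fixes t :: real
  assumes "0 \<le> t" "t \<le> 1"
  shows "emeasure lebesgue (ball (0 :: 'a::euclidean_space) 1 - ball 0 (1 - t))
    \<le> ennreal (measure lborel (ball (0 :: 'a) 1) * real DIM('a) * t)"
proof -
  let ?V = "measure lborel (ball (0 :: 'a) 1)"
  have V: "measure lborel (ball (0 :: 'a) (1 - t)) = ?V * (1 - t) ^ DIM('a)"
    using assms by (simp add: content_ball)
  have "1 - real DIM('a) * t \<le> (1 - t) ^ DIM('a)"
    using Bernoulli_inequality[of "- t" "DIM('a)"] assms by simp
  then have "?V * (1 - real DIM('a) * t) \<le> ?V * (1 - t) ^ DIM('a)"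
    by (intro mult_left_mono) auto
  then have "?V - ?V * (1 - t) ^ DIM('a) \<le> ?V * real DIM('a) * t"
    by (simp add: algebra_simps)
  moreover have "emeasure lebesgue (ball (0 :: 'a) 1 - ball 0 (1 - t))
      = ennreal (?V - ?V * (1 - t) ^ DIM('a))"
  proof -
    have "emeasure lebesgue (ball (0 :: 'a) 1 - ball 0 (1 - t))
        = emeasure lebesgue (ball (0 :: 'a) 1) - emeasure lebesgue (ball (0 :: 'a) (1 - t))"
      using assms emeasure_lborel_ball_finite[of "0 :: 'a" "1 - t"] by (intro emeasure_Diff) auto
    also have "\<dots> = ennreal ?V - ennreal (?V * (1 - t) ^ DIM('a))"
    proof -
      have "emeasure lebesgue (ball (0 :: 'a) r) = ennreal (measure lborel (ball (0 :: 'a) r))" for r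
        using emeasure_lborel_ball_finite[of "0 :: 'a" r] by (subst emeasure_eq_ennreal_measure[symmetric]) auto
      then show ?thesis by (simp only: V)
    qed
    also have "\<dots> = ennreal (?V - ?V * (1 - t) ^ DIM('a))"
      using assms by (intro ennreal_minus) auto
    finally show ?thesis .
  qed
  ultimately show ?thesis by (simp add: ennreal_leI)
qed

text \<open>Choose k with 2^-(k+1) < 1 - |z| <= 2^-k. Since 1 - |z| <= 1 - |z|^2 and the exponent is
  negative, the k-th term alone dominates the weight. The shells are nested, so other terms may be
  nonzero as well, but they are nonnegative.\<close>

lemma ball_weight_le_shells:
  fixes z :: "'a::euclidean_space"
  assumes z: "z \<in> ball 0 1" and \<alpha>: "\<alpha> < 0"
  shows "ennreal ((1 - (norm z)\<^sup>2) powr \<alpha>) \<le>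
    (\<Sum>k. ennreal ((1 / 2 ^ Suc k) powr \<alpha>) *
      indicator (ball (0 :: 'a) 1 - ball 0 (1 - 1 / 2 ^ k)) z)"
proof -
  define d where "d = 1 - norm z"
  have d: "0 < d" "d \<le> 1" using z by (auto simp: d_def)
  have ex: "\<exists>k. (1 / 2) ^ k < d" using d real_arch_pow_inv[of d "1/2"] by auto
  define m where "m = (LEAST k. (1 / 2) ^ k < d)"
  have m: "(1 / 2) ^ m < d" unfolding m_def using ex by (rule LeastI_ex)
  have "m \<noteq> 0" using m d by (cases m) auto
  then obtain k where k: "m = Suc k" using not0_implies_Suc by blast
  have dk: "d \<le> (1 / 2) ^ k"
    using not_less_Least[of k "\<lambda>k. (1 / 2) ^ k < d"] k unfolding m_def by fastforce
  have "d \<le> 1 - (norm z)\<^sup>2"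
    using z unfolding d_def by (simp add: power2_eq_square mult_left_le)
  then have "(1 - (norm z)\<^sup>2) powr \<alpha> \<le> d powr \<alpha>"
    using d \<alpha> by (intro powr_mono2') auto
  also have "\<dots> \<le> (1 / 2 ^ Suc k) powr \<alpha>"
    using m k d \<alpha> by (intro powr_mono2') (auto simp: power_divide)
  finally have "ennreal ((1 - (norm z)\<^sup>2) powr \<alpha>) \<le> ennreal ((1 / 2 ^ Suc k) powr \<alpha>)"
    by (rule ennreal_leI)
  also have "\<dots> = ennreal ((1 / 2 ^ Suc k) powr \<alpha>) *
      indicator (ball (0 :: 'a) 1 - ball 0 (1 - 1 / 2 ^ k)) z"
    using z dk by (auto simp: d_def power_divide indicator_def)
  also have "\<dots> = sum (\<lambda>j. ennreal ((1 / 2 ^ Suc j) powr \<alpha>) *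
      indicator (ball (0 :: 'a) 1 - ball 0 (1 - 1 / 2 ^ j)) z) {k}"
    by (simp only: sum.empty sum.insert finite.emptyI empty_iff not_False_eq_True add_0_right)
  also have "\<dots> \<le> (\<Sum>j. ennreal ((1 / 2 ^ Suc j) powr \<alpha>) *
      indicator (ball (0 :: 'a) 1 - ball 0 (1 - 1 / 2 ^ j)) z)"
    by (rule sum_le_suminf) auto
  finally show ?thesis .
qed

text \<open>For negative exponents the k-th dyadic shell contributes a constant times the k-th power
  of (1/2)^(1 + alpha), a ratio below 1 exactly because alpha > -1. For nonnegative exponents the
  weight is at most 1.\<close>

lemma set_integrable_ball_weight:
  assumes \<alpha>: "\<alpha> > -1"
  shows "set_integrable lebesgue (ball (0 :: 'a::euclidean_space) 1) (\<lambda>w. (1 - (norm w)\<^sup>2) powr \<alpha>)"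
proof -
  let ?f = "\<lambda>w :: 'a. indicator (ball 0 1) w *\<^sub>R (1 - (norm w)\<^sup>2) powr \<alpha>"
  have meas: "?f \<in> borel_measurable lebesgue"
  proof (rule measurable_completion)
    have [measurable]: "ball (0 :: 'a) 1 \<in> sets lborel" by simp
    show "?f \<in> borel_measurable lborel" by measurable
  qed
  have "(\<integral>\<^sup>+w. ennreal (norm (?f w)) \<partial>lebesgue) < \<infinity>"
  proof (cases "\<alpha> < 0")
    case True
    let ?V = "measure lborel (ball (0 :: 'a) 1) * real DIM('a)"
    have "(\<integral>\<^sup>+w. ennreal (norm (?f w)) \<partial>lebesgue) \<le>
      (\<integral>\<^sup>+w. (\<Sum>k. ennreal ((1 / 2 ^ Suc k) powr \<alpha>) *
        indicator (ball (0 :: 'a) 1 - ball 0 (1 - 1 / 2 ^ k)) w) \<partial>lebesgue)"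
    proof (rule nn_integral_mono)
      fix w :: 'a
      show "ennreal (norm (?f w)) \<le> (\<Sum>k. ennreal ((1 / 2 ^ Suc k) powr \<alpha>) *
        indicator (ball (0 :: 'a) 1 - ball 0 (1 - 1 / 2 ^ k)) w)"
        using ball_weight_le_shells[OF _ True, of w] by (cases "w \<in> ball 0 1") auto
    qed
    also have "\<dots> = (\<Sum>k. ennreal ((1 / 2 ^ Suc k) powr \<alpha>) *
        emeasure lebesgue (ball (0 :: 'a) 1 - ball 0 (1 - 1 / 2 ^ k)))"
    proof -
      have shell: "ball (0 :: 'a) 1 - ball 0 r \<in> sets lebesgue" for r
        by (intro sets.Diff) simp_all
      show ?thesis
        by (subst nn_integral_suminf)
           (intro borel_measurable_times_ennreal borel_measurable_const borel_measurable_indicator shell,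
            simp only: nn_integral_cmult_indicator[OF shell])
    qed
    also have "\<dots> \<le> (\<Sum>k. ennreal ((1 / 2 ^ Suc k) powr \<alpha>) * ennreal (?V * (1 / 2 ^ k)))"
      by (intro suminf_le mult_left_mono emeasure_spherical_shell_le) auto
    also have "\<dots> = (\<Sum>k. ennreal (?V * (1/2) powr \<alpha> * ((1/2) powr (1 + \<alpha>)) ^ k))"
    proof -
      have "(1 / 2 ^ Suc k) powr \<alpha> * (?V * (1 / 2 ^ k)) = ?V * (1/2) powr \<alpha> * ((1/2) powr (1 + \<alpha>)) ^ k"
        for k
      proof -
        have "(1 / 2 :: real) ^ n = (1/2) powr real n" for n by (simp add: powr_realpow)
        then have "(1 / 2 ^ Suc k) powr \<alpha> * (1 / 2 ^ k) = (1/2) powr (real (Suc k) * \<alpha> + real k)"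
          unfolding power_one_over[symmetric] by (simp only: powr_powr powr_add)
        also have "\<dots> = (1/2) powr (\<alpha> + (1 + \<alpha>) * real k)"
          by (simp add: algebra_simps)
        also have "\<dots> = (1/2) powr \<alpha> * ((1/2) powr (1 + \<alpha>)) ^ k"
          by (simp add: powr_add powr_powr[symmetric] powr_realpow)
        finally have eq: "(1 / 2 ^ Suc k) powr \<alpha> * (1 / 2 ^ k) = (1/2) powr \<alpha> * ((1/2) powr (1 + \<alpha>)) ^ k" .
        show ?thesis by (subst mult.left_commute, subst eq, simp only: mult.assoc)
      qed
      then show ?thesis by (simp add: ennreal_mult''[symmetric])
    qed
    also have "\<dots> < \<infinity>"
    proof -
      have "(1/2 :: real) powr (1 + \<alpha>) < 1" using \<alpha> powr_less_mono2[of "1+\<alpha>" "1/2" 1] by simp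
      then have "summable (\<lambda>k. ?V * (1/2) powr \<alpha> * ((1/2) powr (1 + \<alpha>)) ^ k)"
        by (intro summable_mult summable_geometric) simp
      then show ?thesis by (subst suminf_ennreal2) auto
    qed
    finally show ?thesis .
  next
    case False
    have "(\<integral>\<^sup>+w. ennreal (norm (?f w)) \<partial>lebesgue) \<le> (\<integral>\<^sup>+w. indicator (ball (0 :: 'a) 1) w \<partial>lebesgue)"
      using False by (intro nn_integral_mono)
        (auto simp: indicator_def power_le_one powr_le1 abs_square_le_1 intro!: powr_le1)
    also have "\<dots> < \<infinity>" using emeasure_lborel_ball_finite[of "0 :: 'a" 1] by simp
    finally show ?thesis .
  qed
  then show ?thesis unfolding set_integrable_def integrable_iff_bounded using meas by blast
qed

text \<open>This integral is the denominator in \<open>nu\<close>. The weight has no zero on the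
  ball, so a vanishing integral would make the ball a null set.\<close>

lemma set_integral_ball_weight_pos:
  assumes \<alpha>: "\<alpha> > -1"
  shows "(LINT w:ball (0 :: 'a::euclidean_space) 1|lebesgue. (1 - (norm w)\<^sup>2) powr \<alpha>) > 0"
proof -
  let ?f = "\<lambda>w :: 'a. indicator (ball 0 1) w *\<^sub>R (1 - (norm w)\<^sup>2) powr \<alpha>"
  have int: "integrable lebesgue ?f"
    using set_integrable_ball_weight[OF \<alpha>] by (simp add: set_integrable_def)
  have "integral\<^sup>L lebesgue ?f \<noteq> 0"
  proof
    assume "integral\<^sup>L lebesgue ?f = 0"
    then have "AE w in lebesgue. ?f w = 0"
      using integral_nonneg_eq_0_iff_AE[OF int] by simp
    then have "AE w in lebesgue. w \<notin> ball (0 :: 'a) 1"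
      by eventually_elim (auto simp: abs_square_eq_1 power2_eq_1_iff split: if_splits)
    then have "emeasure lebesgue (ball (0 :: 'a) 1) = 0"
      by (subst (asm) AE_iff_null_sets[symmetric]) (auto simp: null_sets_def)
    then show False
      using content_ball_gt_0_iff[of "0 :: 'a" 1] by (simp add: measure_def)
  qed
  moreover have "integral\<^sup>L lebesgue ?f \<ge> 0" by simp
  ultimately show ?thesis unfolding set_lebesgue_integral_def by linarith
qed

section \<open>The probability measure \<open>nu\<close> and its null sets\<close>

lemma space_nu [simp]: "space (nu \<alpha> :: (complex ^ 'n) measure) = ball 0 1"
  by (simp add: nu_def)

lemma sets_nu [measurable_cong]: "sets (nu \<alpha> :: (complex ^ 'n) measure) = sets (lebesgue_on (ball 0 1))"
  by (simp add: nu_def)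

lemma nu_density_measurable:
  "(\<lambda>z :: complex ^ 'n. ennreal ((1 - (norm z)\<^sup>2) powr \<alpha> / c)) \<in> borel_measurable (lebesgue_on (ball 0 1))"
  by (intro measurable_restrict_space1 measurable_completion) measurable

text \<open>Functions extended by 0 may jump at the sphere, so continuity is available only on the
  ball itself; hence the detour through the restricted Borel sigma-algebra.\<close>

lemma continuous_on_ball_imp_nu_measurable:
  fixes f :: "complex ^ 'n \<Rightarrow> 'b::topological_space"
  assumes "continuous_on (ball 0 1) f"
  shows "f \<in> borel_measurable (nu \<alpha>)"
proof -
  have "f \<in> borel_measurable (restrict_space borel (ball 0 1))"
    using assms by (rule borel_measurable_continuous_on_restrict)
  then have "f \<in> borel_measurable (lebesgue_on (ball 0 1))"
  proof (rule measurable_compose[rotated])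
    show "(\<lambda>z. z) \<in> lebesgue_on (ball 0 1) \<rightarrow>\<^sub>M restrict_space borel (ball (0 :: complex ^ 'n) 1)"
      by (rule measurable_restrict_space3) (auto intro: measurable_completion)
  qed
  then show ?thesis by (simp add: measurable_cong_sets[OF sets_nu])
qed

text \<open>The density is strictly positive on the ball, so both measures have the same null
  sets.\<close>

lemma AE_nu_iff:
  assumes "\<alpha> > -1"
  shows "(AE z in nu \<alpha>. P z) \<longleftrightarrow> (AE z in lebesgue_on (ball (0 :: complex ^ 'n) 1). P z)"
proof -
  have *: "0 < ennreal ((1 - (norm z)\<^sup>2) powr \<alpha> /
     (LINT w:ball 0 1|(lebesgue :: (complex ^ 'n) measure). (1 - (norm w)\<^sup>2) powr \<alpha>))"
    if "z \<in> ball 0 1" for z :: "complex ^ 'n"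
  proof -
    have "(norm z)\<^sup>2 < 1" using that by (simp add: abs_square_less_1)
    then show ?thesis
      using set_integral_ball_weight_pos[OF assms, where 'a = "complex ^ 'n"] by simp
  qed
  have "(AE z in nu \<alpha>. P z) \<longleftrightarrow> (AE z in lebesgue_on (ball (0 :: complex ^ 'n) 1).
      0 < ennreal ((1 - (norm z)\<^sup>2) powr \<alpha> /
     (LINT w:ball 0 1|(lebesgue :: (complex ^ 'n) measure). (1 - (norm w)\<^sup>2) powr \<alpha>)) \<longrightarrow> P z)"
    unfolding nu_def by (rule AE_density[OF nu_density_measurable])
  also have "\<dots> \<longleftrightarrow> (AE z in lebesgue_on (ball (0 :: complex ^ 'n) 1). P z)"
    by (rule AE_cong) (use * in auto)
  finally show ?thesis .
qed

lemma emeasure_nu_ball: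
  assumes \<alpha>: "\<alpha> > -1"
  shows "emeasure (nu \<alpha>) (ball (0 :: complex ^ 'n) 1) = 1"
proof -
  let ?c = "LINT w:ball 0 1|(lebesgue :: (complex ^ 'n) measure). (1 - (norm w)\<^sup>2) powr \<alpha>"
  have c: "?c > 0" by (rule set_integral_ball_weight_pos[OF \<alpha>])
  have "emeasure (nu \<alpha>) (ball (0 :: complex ^ 'n) 1) =
    (\<integral>\<^sup>+z. ennreal ((1 - (norm z)\<^sup>2) powr \<alpha> / ?c) * indicator (ball (0 :: complex ^ 'n) 1) z \<partial>lebesgue_on (ball 0 1))"
    unfolding nu_def by (rule emeasure_density[OF nu_density_measurable]) (auto simp: sets_restrict_space)
  also have "\<dots> = (\<integral>\<^sup>+z. ennreal (indicator (ball (0 :: complex ^ 'n) 1) z *\<^sub>R (1 - (norm z)\<^sup>2) powr \<alpha> / ?c) \<partial>lebesgue)"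
    by (subst nn_integral_restrict_space) (auto intro!: nn_integral_cong simp: indicator_def)
  also have "\<dots> = ennreal (integral\<^sup>L lebesgue (\<lambda>z. indicator (ball (0 :: complex ^ 'n) 1) z *\<^sub>R (1 - (norm z)\<^sup>2) powr \<alpha> / ?c))"
    using set_integrable_ball_weight[OF \<alpha>, where 'a = "complex ^ 'n"] c
    by (intro nn_integral_eq_integral) (auto simp: set_integrable_def)
  also have "integral\<^sup>L lebesgue (\<lambda>z. indicator (ball (0 :: complex ^ 'n) 1) z *\<^sub>R (1 - (norm z)\<^sup>2) powr \<alpha> / ?c) = 1"
    using c by (simp add: set_lebesgue_integral_def)
  finally show ?thesis by simp
qed

lemma finite_measure_nu: "\<alpha> > -1 \<Longrightarrow> finite_measure (nu \<alpha> :: (complex ^ 'n) measure)"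
  by (rule finite_measureI) (simp add: emeasure_nu_ball)

lemma measure_nu_ball: "\<alpha> > -1 \<Longrightarrow> measure (nu \<alpha>) (ball (0 :: complex ^ 'n) 1) = 1"
  by (simp add: measure_def emeasure_nu_ball)

lemma sub_ball_in_sets_nu [measurable]:
  "ball (0 :: complex ^ 'n) (1/2) \<in> sets (nu \<alpha>)"
  by (auto simp: sets_nu sets_restrict_space_iff subset_eq)

text \<open>Nonempty open sets are not Lebesgue null. It serves twice: a continuous function that
  vanishes almost everywhere vanishes on the whole ball, and the small ball has positive
  measure.\<close>

lemma AE_nu_open_imp_empty:
  assumes "\<alpha> > -1" and U: "open U" "U \<subseteq> ball (0 :: complex ^ 'n) 1" and ae: "AE z in nu \<alpha>. z \<notin> U"
  shows "U = {}"
proof -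
  have "AE z in lebesgue_on (ball (0 :: complex ^ 'n) 1). z \<notin> U"
    using ae AE_nu_iff[OF assms(1), of "\<lambda>z. z \<notin> U"] by simp
  then have "AE z in lebesgue. z \<notin> U"
    using U by (subst (asm) AE_restrict_space_iff) (auto elim!: eventually_mono)
  then have "U \<in> null_sets lebesgue"
    using U by (subst AE_iff_null_sets) auto
  then show ?thesis using U(1) open_not_negligible negligible_iff_null_sets by blast
qed

section \<open>Sequence space and strong integrals\<close>

lemma norm_scaleC: "norm (c *\<^sub>C x) = cmod c * norm x"
  by (simp add: norm_ell2_def scaleC_ell2.rep_eq norm_mult power_mult_distrib
      suminf_mult[OF ell2_summable] real_sqrt_mult)

lemma bounded_bilinear_scaleC: "bounded_bilinear (*\<^sub>C)"
proof
  fix a a' :: complex and b b' :: ell2 and r :: real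
  show "(a + a') *\<^sub>C b = a *\<^sub>C b + a' *\<^sub>C b" "a *\<^sub>C (b + b') = a *\<^sub>C b + a *\<^sub>C b'"
    "(r *\<^sub>R a) *\<^sub>C b = r *\<^sub>R (a *\<^sub>C b)" "a *\<^sub>C (r *\<^sub>R b) = r *\<^sub>R (a *\<^sub>C b)"
    by (transfer; simp add: algebra_simps)+
  show "\<exists>K. \<forall>a b. norm (a *\<^sub>C b) \<le> norm a * norm b * K"
    by (rule exI[of _ 1]) (simp add: norm_scaleC)
qed

interpretation scaleC: bounded_bilinear "(*\<^sub>C)"
  by (rule bounded_bilinear_scaleC)

lemma scaleC_scaleC: "a *\<^sub>C b *\<^sub>C x = (a * b) *\<^sub>C x"
  by transfer (simp add: mult.assoc)

lemma scaleC_one: "1 *\<^sub>C x = x"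
  by transfer simp

lemma summable_cinner: "summable (\<lambda>i. coord x i * cnj (coord y i))"
  by (rule summable_norm_cancel)
     (simp add: norm_mult ell2_summable_mult[OF ell2_summable ell2_summable])

text \<open>The bridge from the real inner product, which carries the topology, to the complex one,
  in which orthonormality is expressed.\<close>

lemma inner_scaleC_right: "x \<bullet> (c *\<^sub>C y) = Re (cnj c * cinner_ell2 x y)"
proof -
  have "cnj c * cinner_ell2 x y = (\<Sum>i. cnj c * (coord x i * cnj (coord y i)))"
    unfolding cinner_ell2_def by (rule suminf_mult[OF summable_cinner, symmetric])
  then have "Re (cnj c * cinner_ell2 x y) = (\<Sum>i. Re (cnj c * (coord x i * cnj (coord y i))))"
    using bounded_linear.suminf[OF bounded_linear_Re summable_mult[OF summable_cinner]] by simp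
  also have "\<dots> = x \<bullet> (c *\<^sub>C y)"
    unfolding inner_ell2_def by (simp add: scaleC_ell2.rep_eq inner_complex_def algebra_simps)
  finally show ?thesis by simp
qed

lemma orthonormal_basis_norm:
  assumes "ell2_orthonormal_basis e"
  shows "norm (e k) = 1"
proof -
  have "cinner_ell2 (e k) (e k) = 1"
    using assms by (simp add: ell2_orthonormal_basis_def)
  then show ?thesis
    using inner_scaleC_right[of "e k" 1 "e k"] by (simp add: scaleC_one norm_eq_sqrt_inner)
qed

text \<open>Such an x is real-orthogonal to every complex combination of the basis, hence by
  continuity to the closure of their set, and so to x itself.\<close>

lemma orthonormal_basis_total:
  assumes e: "ell2_orthonormal_basis e" and x: "\<And>k. cinner_ell2 x (e k) = 0"
  shows "x = 0"
proof -
  let ?S = "{\<Sum>j<N. c j *\<^sub>C e j | (N :: nat) (c :: nat \<Rightarrow> complex). True}"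
  have "closed {y. x \<bullet> y = 0}"
    by (intro closed_Collect_eq continuous_intros)
  moreover have "?S \<subseteq> {y. x \<bullet> y = 0}"
    by (auto simp: inner_sum_right inner_scaleC_right x)
  ultimately have "closure ?S \<subseteq> {y. x \<bullet> y = 0}"
    by (rule closure_minimal[rotated])
  moreover have "closure ?S = UNIV"
    using e unfolding ell2_orthonormal_basis_def by blast
  ultimately have "x \<bullet> x = 0" by blast
  then show ?thesis by simp
qed

section \<open>Strong integrals of a real function times a fixed vector\<close>

lemma strongly_measurable_cong:
  assumes "\<And>x. x \<in> space M \<Longrightarrow> f x = g x" and "strongly_measurable M f"
  shows "strongly_measurable M g"
  using assms(2) unfolding strongly_measurable_def
proof (elim exE conjE)
  fix s assume s: "\<forall>i::nat. simple_function M (s i)" "AE x in M. (\<lambda>i. s i x) \<longlonglongrightarrow> f x"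
  have "AE x in M. (\<lambda>i. s i x) \<longlonglongrightarrow> g x"
    using s(2) AE_space by eventually_elim (simp add: assms(1))
  then show "\<exists>s. (\<forall>i::nat. simple_function M (s i)) \<and> (AE x in M. (\<lambda>i. s i x) \<longlonglongrightarrow> g x)"
    using s(1) by (intro exI[of _ s]) simp
qed

lemma strongly_measurable_if_borel:
  fixes f :: "'a \<Rightarrow> 'e::{real_normed_vector, second_countable_topology}"
  assumes "f \<in> borel_measurable M"
  shows "strongly_measurable M f"
proof -
  obtain s where "\<And>i. simple_function M (s i)" "\<And>x. x \<in> space M \<Longrightarrow> (\<lambda>i. s i x) \<longlonglongrightarrow> f x"
    using borel_measurable_implies_sequence_metric[OF assms, of 0] by blast
  then show ?thesis unfolding strongly_measurable_def by (intro exI[of _ s]) auto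
qed

lemma strongly_measurable_scaleR_const:
  fixes g :: "'a \<Rightarrow> real" and A :: "'e::real_normed_vector"
  assumes "g \<in> borel_measurable M"
  shows "strongly_measurable M (\<lambda>x. g x *\<^sub>R A)"
proof -
  obtain s where s: "\<And>i. simple_function M (s i)" "\<And>x. x \<in> space M \<Longrightarrow> (\<lambda>i. s i x) \<longlonglongrightarrow> g x"
    using borel_measurable_implies_sequence_metric[OF assms, of 0] by blast
  have "simple_function M (\<lambda>x. s i x *\<^sub>R A)" for i
    using simple_function_compose1[OF s(1), of "\<lambda>r. r *\<^sub>R A"] by simp
  then show ?thesis unfolding strongly_measurable_def
    using s(2) by (intro exI[of _ "\<lambda>i x. s i x *\<^sub>R A"]) (auto intro!: AE_I2 tendsto_intros)
qed

text \<open>Simple functions approximating \<open>g\<close> approximate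
  \<open>g x *\<^sub>R A\<close> after multiplication by \<open>A\<close>; the error integrals are
  merely scaled by \<open>norm A\<close>.\<close>

lemma has_strong_integral_scaleR_const:
  fixes g :: "'a \<Rightarrow> real" and A :: "'e::real_normed_vector"
  assumes "has_bochner_integral M g I"
  shows "has_strong_integral M (\<lambda>x. g x *\<^sub>R A) (I *\<^sub>R A)"
proof -
  obtain s where g: "g \<in> borel_measurable M"
    and s: "\<And>i. Bochner_Integration.simple_bochner_integrable M (s i)"
    and lim: "(\<lambda>i. \<integral>\<^sup>+x. ennreal (norm (g x - s i x)) \<partial>M) \<longlonglongrightarrow> 0"
    and int: "(\<lambda>i. Bochner_Integration.simple_bochner_integral M (s i)) \<longlonglongrightarrow> I"
    using assms by (auto simp: has_bochner_integral.simps)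
  have sm [measurable]: "s i \<in> borel_measurable M" for i
    using s[of i] by (auto intro: borel_measurable_simple_function elim: Bochner_Integration.simple_bochner_integrable.cases)
  note g [measurable]
  have "(\<integral>\<^sup>+x. ennreal (norm (g x *\<^sub>R A - s i x *\<^sub>R A)) \<partial>M)
      = ennreal (norm A) * (\<integral>\<^sup>+x. ennreal (norm (g x - s i x)) \<partial>M)" for i
    by (subst nn_integral_cmult[symmetric])
       (auto simp: ennreal_mult[symmetric] mult.commute simp flip: scaleR_diff_left)
  moreover have "(\<lambda>i. ennreal (norm A) * (\<integral>\<^sup>+x. ennreal (norm (g x - s i x)) \<partial>M)) \<longlonglongrightarrow> ennreal (norm A) * 0"
    by (rule ennreal_tendsto_cmult[OF _ lim]) simp
  ultimately have "(\<lambda>i. \<integral>\<^sup>+x. ennreal (norm (g x *\<^sub>R A - s i x *\<^sub>R A)) \<partial>M) \<longlonglongrightarrow> 0"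
    by simp
  moreover have "Bochner_Integration.simple_bochner_integrable M (\<lambda>x. s i x *\<^sub>R A)" for i
    using Bochner_Integration.simple_bochner_integrable_compose2[OF _ s s, of "\<lambda>r _. r *\<^sub>R A" i i] by simp
  moreover have "(\<lambda>i. Bochner_Integration.simple_bochner_integral M (\<lambda>x. s i x *\<^sub>R A)) \<longlonglongrightarrow> I *\<^sub>R A"
    using tendsto_scaleR[OF int tendsto_const[of A]]
      simple_bochner_integral_linear[OF _ s, of "\<lambda>r. r *\<^sub>R A"]
    by (simp add: linear_iff scaleR_add_left)
  ultimately show ?thesis
    unfolding has_strong_integral_def using strongly_measurable_scaleR_const[OF g, of A]
    by (intro conjI exI[of _ "\<lambda>i x. s i x *\<^sub>R A"] allI)
qed

text \<open>In a non-separable space a difference of Borel functions need not be Borel. Here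
  \<open>s\<close> has finitely many values, and where \<open>s\<close> equals y the function is a
  continuous function of the real number \<open>g x\<close>.\<close>

lemma measurable_norm_scaleR_const_diff_simple:
  fixes g :: "'a \<Rightarrow> real" and A :: "'e::real_normed_vector"
  assumes g: "g \<in> borel_measurable M" and s: "simple_function M s"
  shows "(\<lambda>x. norm (g x *\<^sub>R A - s x)) \<in> borel_measurable M"
proof (rule measurable_compose_countable'[where I = "s ` space M" and g = s])
  show "countable (s ` space M)"
    using simple_functionD(1)[OF s] by (rule countable_finite)
  show "s \<in> measurable M (count_space (s ` space M))"
    using s by (auto simp: simple_function_def measurable_count_space_eq2)
  show "(\<lambda>x. norm (g x *\<^sub>R A - y)) \<in> borel_measurable M" for y
  proof -
    have "(\<lambda>r :: real. norm (r *\<^sub>R A - y)) \<in> borel_measurable borel"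
      by (intro borel_measurable_continuous_onI continuous_intros)
    from measurable_compose[OF g this] show ?thesis .
  qed
qed

text \<open>Triangle inequality through the common target \<open>g x *\<^sub>R A\<close>. Additivity
  of the nonnegative integral in the last step rests on the measurability just shown.\<close>

lemma simple_integral_diff_bounded:
  fixes g :: "'a \<Rightarrow> real" and A :: "'e::real_normed_vector"
  assumes g: "g \<in> borel_measurable M"
    and s: "Bochner_Integration.simple_bochner_integrable M s"
    and t: "Bochner_Integration.simple_bochner_integrable M t"
  shows "ennreal (norm (Bochner_Integration.simple_bochner_integral M s - Bochner_Integration.simple_bochner_integral M t)) \<le>
    (\<integral>\<^sup>+ x. ennreal (norm (g x *\<^sub>R A - s x)) \<partial>M) + (\<integral>\<^sup>+ x. ennreal (norm (g x *\<^sub>R A - t x)) \<partial>M)"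
proof -
  have simple: "simple_function M s" "simple_function M t"
    using s t by (auto elim: Bochner_Integration.simple_bochner_integrable.cases)
  have "ennreal (norm (Bochner_Integration.simple_bochner_integral M s - Bochner_Integration.simple_bochner_integral M t))
      = ennreal (norm (Bochner_Integration.simple_bochner_integral M (\<lambda>x. s x - t x)))"
    using s t by (subst simple_bochner_integral_diff) auto
  also have "\<dots> \<le> ennreal (Bochner_Integration.simple_bochner_integral M (\<lambda>x. norm (s x - t x)))"
    using simple_bochner_integrable_compose2[of "(-)" M s t] s t
    by (auto intro!: ennreal_leI simple_bochner_integral_norm_bound)
  also have "\<dots> = (\<integral>\<^sup>+x. ennreal (norm (s x - t x)) \<partial>M)"
    using simple_bochner_integrable_compose2[of "\<lambda>x y. norm (x - y)" M s t] s t
    by (auto intro!: simple_bochner_integral_eq_nn_integral)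
  also have "\<dots> \<le> (\<integral>\<^sup>+x. ennreal (norm (g x *\<^sub>R A - s x)) + ennreal (norm (g x *\<^sub>R A - t x)) \<partial>M)"
  proof (rule nn_integral_mono)
    fix x
    have "norm (s x - t x) \<le> norm (g x *\<^sub>R A - s x) + norm (g x *\<^sub>R A - t x)"
      by (metis dual_order.refl norm_diff_triangle_le norm_minus_commute)
    then show "ennreal (norm (s x - t x)) \<le> ennreal (norm (g x *\<^sub>R A - s x)) + ennreal (norm (g x *\<^sub>R A - t x))"
      by (metis ennreal_leI ennreal_plus norm_ge_zero)
  qed
  also have "\<dots> = (\<integral>\<^sup>+ x. ennreal (norm (g x *\<^sub>R A - s x)) \<partial>M) + (\<integral>\<^sup>+ x. ennreal (norm (g x *\<^sub>R A - t x)) \<partial>M)"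
    by (intro nn_integral_add measurable_compose[OF measurable_norm_scaleR_const_diff_simple[OF g] measurable_ennreal] simple)
  finally show ?thesis .
qed

text \<open>\<open>strong_integral\<close> is a definite description, so uniqueness is required. The
  competing approximants are arbitrary simple functions, not multiples of \<open>A\<close>; their
  integrals nevertheless merge, as both error integrals tend to 0.\<close>

lemma has_strong_integral_scaleR_const_unique:
  fixes g :: "'a \<Rightarrow> real" and A :: "'e::real_normed_vector"
  assumes g: "g \<in> borel_measurable M"
    and J: "has_strong_integral M (\<lambda>x. g x *\<^sub>R A) J"
    and K: "has_strong_integral M (\<lambda>x. g x *\<^sub>R A) K"
  shows "J = K"
  using J K unfolding has_strong_integral_def
proof (elim conjE exE)
  fix s t
  assume s: "\<forall>i::nat. Bochner_Integration.simple_bochner_integrable M (s i)"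
      "(\<lambda>i. \<integral>\<^sup>+x. ennreal (norm (g x *\<^sub>R A - s i x)) \<partial>M) \<longlonglongrightarrow> 0"
      "(\<lambda>i. Bochner_Integration.simple_bochner_integral M (s i)) \<longlonglongrightarrow> J"
    and t: "\<forall>i::nat. Bochner_Integration.simple_bochner_integrable M (t i)"
      "(\<lambda>i. \<integral>\<^sup>+x. ennreal (norm (g x *\<^sub>R A - t i x)) \<partial>M) \<longlonglongrightarrow> 0"
      "(\<lambda>i. Bochner_Integration.simple_bochner_integral M (t i)) \<longlonglongrightarrow> K"
  have "(\<lambda>i. ennreal (norm (Bochner_Integration.simple_bochner_integral M (s i)
      - Bochner_Integration.simple_bochner_integral M (t i)))) \<longlonglongrightarrow> 0"
  proof (rule tendsto_sandwich[OF always_eventually always_eventually tendsto_const])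
    show "\<forall>i. ennreal (norm (Bochner_Integration.simple_bochner_integral M (s i)
      - Bochner_Integration.simple_bochner_integral M (t i))) \<le>
      (\<integral>\<^sup>+x. ennreal (norm (g x *\<^sub>R A - s i x)) \<partial>M) + (\<integral>\<^sup>+x. ennreal (norm (g x *\<^sub>R A - t i x)) \<partial>M)"
      using simple_integral_diff_bounded[OF g] s(1) t(1) by blast
    show "(\<lambda>i. (\<integral>\<^sup>+x. ennreal (norm (g x *\<^sub>R A - s i x)) \<partial>M)
      + (\<integral>\<^sup>+x. ennreal (norm (g x *\<^sub>R A - t i x)) \<partial>M)) \<longlonglongrightarrow> 0"
      using tendsto_add[OF s(2) t(2)] by simp
  qed simp
  then have "(\<lambda>i. norm (Bochner_Integration.simple_bochner_integral M (s i)
      - Bochner_Integration.simple_bochner_integral M (t i))) \<longlonglongrightarrow> 0"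
    by (simp add: ennreal_0[symmetric] del: ennreal_0)
  moreover have "(\<lambda>i. norm (Bochner_Integration.simple_bochner_integral M (s i)
      - Bochner_Integration.simple_bochner_integral M (t i))) \<longlonglongrightarrow> norm (J - K)"
    by (intro tendsto_intros s t)
  ultimately have "norm (J - K) = 0" using LIMSEQ_unique by blast
  then show ?thesis by simp
qed

lemma strong_integral_scaleR_const:
  fixes g :: "'a \<Rightarrow> real" and A :: "'e::real_normed_vector"
  assumes g: "has_bochner_integral M g I"
  shows "strong_integral M (\<lambda>x. g x *\<^sub>R A) = I *\<^sub>R A"
proof -
  have A: "has_strong_integral M (\<lambda>x. g x *\<^sub>R A) (I *\<^sub>R A)"
    by (rule has_strong_integral_scaleR_const[OF g])
  then have "(THE J. has_strong_integral M (\<lambda>x. g x *\<^sub>R A) J) = I *\<^sub>R A"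
    by (rule the_equality)
       (rule has_strong_integral_scaleR_const_unique[OF borel_measurable_has_bochner_integral[OF g] _ A])
  then show ?thesis unfolding strong_integral_def using A by metis
qed

section \<open>The kernel\<close>

lemma cmod_hdot_le: "cmod (hdot z w) \<le> norm z * norm w"
proof -
  have "cmod (hdot z w) \<le> (\<Sum>k\<in>UNIV. cmod (z $ k * cnj (w $ k)))"
    unfolding hdot_def by (rule norm_sum)
  also have "\<dots> = (\<Sum>k\<in>UNIV. \<bar>norm (z $ k)\<bar> * \<bar>norm (w $ k)\<bar>)"
    by (simp add: norm_mult)
  also have "\<dots> \<le> norm z * norm w"
    unfolding norm_vec_def by (rule L2_set_mult_ineq)
  finally show ?thesis .
qed

lemma hdot_add_left: "hdot (z + h) w = hdot z w + hdot h w"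
  by (simp add: hdot_def algebra_simps sum.distrib)

lemma hdot_diff_left: "hdot (z - h) w = hdot z w - hdot h w"
  by (simp add: hdot_def algebra_simps sum_subtractf)

lemma hdot_scaleR_left: "hdot (r *\<^sub>R z) w = r *\<^sub>R hdot z w"
  by (simp add: hdot_def scaleR_sum_right)

lemma hdot_scale_left: "hdot (c *s z) w = c * hdot z w"
  by (simp add: hdot_def sum_distrib_left mult.assoc)

lemma cnj_hdot: "cnj (hdot w z) = hdot z w"
  by (simp add: hdot_def mult.commute)

lemma continuous_on_hdot [continuous_intros]:
  "continuous_on A f \<Longrightarrow> continuous_on A g \<Longrightarrow> continuous_on A (\<lambda>x. hdot (f x) (g x))"
  unfolding hdot_def by (intro continuous_intros)

lemma cmod_hdot_lt_1:
  assumes "norm z < 1" "norm w < 1"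
  shows "cmod (hdot z w) < 1"
proof -
  have "norm z * norm w \<le> norm z * 1" using assms by (intro mult_left_mono) auto
  then show ?thesis using cmod_hdot_le[of z w] assms(1) by linarith
qed

lemma cmod_hdot_le_half:
  assumes "norm z < 1" "norm w < 1/2"
  shows "cmod (hdot z w) \<le> 1/2"
proof -
  have "norm z * norm w \<le> 1 * (1/2)" using assms by (intro mult_mono) auto
  then show ?thesis using cmod_hdot_le[of z w] by linarith
qed

text \<open>The \<^term>\<open>i\<close>-th derivative of the one-variable kernel \<open>(1 - u) powr (- s)\<close>.\<close>

definition ker_deriv :: "real \<Rightarrow> nat \<Rightarrow> complex \<Rightarrow> complex" where
  "ker_deriv s i u = of_real (pochhammer s i) * (1 - u) powr of_real (- (s + real i))"

text \<open>The real part of 1 - u is positive, so the principal power stays off its branch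
  cut.\<close>

lemma one_minus_not_nonpos: "cmod u < 1 \<Longrightarrow> 1 - u \<notin> \<real>\<^sub>\<le>\<^sub>0"
  using abs_Re_le_cmod[of u] by (auto simp: complex_nonpos_Reals_iff)

text \<open>The minus sign of the exponent cancels the one from differentiating 1 - u; the remaining
  factor s + i extends the Pochhammer symbol.\<close>

lemma has_field_derivative_ker_deriv:
  assumes "cmod u < 1"
  shows "(ker_deriv s i has_field_derivative ker_deriv s (Suc i) u) (at u within A)"
proof -
  have "(ker_deriv s i has_field_derivative of_real (pochhammer s i) *
      (of_real (- (s + real i)) * (1 - u) powr (of_real (- (s + real i)) - 1) * (0 - 1))) (at u)"
    unfolding ker_deriv_def[abs_def] using one_minus_not_nonpos[OF assms]
    by (intro DERIV_cmult DERIV_chain2[OF has_field_derivative_powr] DERIV_diff DERIV_const DERIV_ident)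
  moreover have "of_real (- (s + real i)) - 1 = (of_real (- (s + real (Suc i))) :: complex)"
    by simp
  moreover have "(of_real (pochhammer s (Suc i)) :: complex) = of_real (pochhammer s i) * of_real (s + real i)"
    by (simp add: pochhammer_rec')
  ultimately have "(ker_deriv s i has_field_derivative ker_deriv s (Suc i) u) (at u)"
    unfolding ker_deriv_def by (simp only:) (simp add: algebra_simps)
  then show ?thesis by (rule DERIV_subset) simp
qed

lemma continuous_on_ker_deriv: "continuous_on (ball 0 1) (ker_deriv s i)"
  by (rule DERIV_continuous_on[OF has_field_derivative_ker_deriv]) simp

text \<open>On the disc of radius 1/2 one has |1 - u| >= 1/2, and the exponent is not positive. This
  is the origin of all the powers of 2 below.\<close>

lemma ker_deriv_bound:
  assumes "0 \<le> s" "cmod u \<le> 1/2"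
  shows "cmod (ker_deriv s i u) \<le> pochhammer s i * 2 powr (s + real i)"
proof -
  have half: "1/2 \<le> cmod (1 - u)"
    using norm_triangle_ineq2[of 1 u] assms(2) by simp
  have "cmod ((1 - u) powr of_real (- (s + real i))) = cmod (1 - u) powr (- (s + real i))"
    by (simp add: norm_powr_real_powr')
  also have "\<dots> \<le> (1/2) powr (- (s + real i))"
    using half assms(1) by (intro powr_mono2') auto
  also have "\<dots> = 2 powr (s + real i)"
    using powr_powr[of 2 "-1" "- (s + real i)"] by (simp add: powr_minus_divide add.commute)
  finally show ?thesis
    using pochhammer_nonneg[of s i] assms(1) unfolding ker_deriv_def norm_mult
    by (cases "s = 0") (auto intro!: mult_left_mono simp: pochhammer_0_left abs_of_nonneg)
qed

text \<open>The constant is the bound for the second derivative on the disc. Being independent of u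
  and v, it lets the quadratic remainder be integrated over w.\<close>

lemma ker_deriv_taylor:
  assumes s: "0 \<le> s" and u: "cmod u \<le> 1/2" and v: "cmod v \<le> 1/2"
  shows "cmod (ker_deriv s 0 v - ker_deriv s 0 u - ker_deriv s 1 u * (v - u))
    \<le> pochhammer s 2 * 2 powr (s + 2) * (cmod (v - u))\<^sup>2"
proof -
  \<comment> \<open>The complex Taylor bound of order 1 divides by \<open>fact 1\<close>, so no
    factor 1/2 appears.\<close>
  have "cmod (ker_deriv s 0 v - (\<Sum>i\<le>1. ker_deriv s i u * (v - u) ^ i / fact i))
    \<le> pochhammer s 2 * 2 powr (s + 2) * cmod (v - u) ^ Suc 1 / fact 1"
  proof (rule complex_Taylor[where S = "cball 0 (1/2)"])
    show "(ker_deriv s i has_field_derivative ker_deriv s (Suc i) x) (at x within cball 0 (1/2))"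
      if "x \<in> cball 0 (1/2)" for i x
      using that by (intro has_field_derivative_ker_deriv) simp
    show "cmod (ker_deriv s (Suc 1) x) \<le> pochhammer s 2 * 2 powr (s + 2)" if "x \<in> cball 0 (1/2)" for x
      using ker_deriv_bound[OF s, of x 2] that by (simp add: numeral_2_eq_2)
  qed (use u v in auto)
  then show ?thesis by (simp add: algebra_simps power2_eq_square)
qed

text \<open>Conjugation commutes with the principal power in the right half-plane. The result
  depends on \<open>hdot z w\<close>, which is complex-linear in z; this is the source of holomorphy
  in z.\<close>

lemma cnj_kernelK:
  fixes z w :: "complex ^ 'n"
  assumes "norm z < 1" "norm w < 1"
  shows "cnj (kernelK \<alpha> z w) = ker_deriv (real CARD('n) + 1 + \<alpha>) 0 (hdot z w)"
proof -
  have "0 \<le> Re (1 - hdot w z)"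
    using cmod_hdot_lt_1[OF assms(2,1)] abs_Re_le_cmod[of "hdot w z"] by simp
  then have "cnj ((1 - hdot w z) powr of_real (- (real CARD('n) + 1 + \<alpha>)))
      = cnj (1 - hdot w z) powr cnj (of_real (- (real CARD('n) + 1 + \<alpha>)))"
    by (intro cnj_powr) auto
  then show ?thesis
    by (simp only: kernelK_def ker_deriv_def complex_cnj_diff complex_cnj_one cnj_hdot complex_cnj_complex_of_real)
       simp
qed

section \<open>A Toeplitz operator with compactly supported symbol\<close>

definition cut_symbol :: "complex ^ 'n \<Rightarrow> ell2 \<Rightarrow>\<^sub>L ell2" where
  "cut_symbol w = indicator (ball 0 (1/2)) w *\<^sub>R id_blinfun"

lemma cut_symbol_apply: "blinfun_apply (cut_symbol w) x = indicator (ball 0 (1/2)) w *\<^sub>R x"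
  by (simp add: cut_symbol_def blinfun.scaleR_left id_blinfun.rep_eq)

lemma borel_measurable_scaleC:
  assumes "f \<in> borel_measurable M" "g \<in> borel_measurable M"
  shows "(\<lambda>x. f x *\<^sub>C g x) \<in> borel_measurable M"
  using borel_measurable_continuous_Pair[OF assms, of "(*\<^sub>C)"]
  by (simp add: scaleC.continuous_on continuous_on_fst continuous_on_snd)

lemma continuous_on_ker_hdot:
  assumes "norm (z :: complex ^ 'n) < 1"
  shows "continuous_on (ball 0 1) (\<lambda>w :: complex ^ 'n. ker_deriv s i (hdot z w))"
  using assms
  by (intro continuous_on_compose2[OF continuous_on_ker_deriv[of s i]] continuous_intros)
     (auto intro: cmod_hdot_lt_1)

context
  fixes f :: "complex ^ 'n \<Rightarrow> ell2" and \<alpha> :: real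
  assumes \<alpha>: "\<alpha> > -1" and f: "integrable (nu \<alpha>) f"
begin

text \<open>The one estimate behind all integrals against the cut symbol. The multiplier
  \<open>m\<close> will be the kernel, its derivative in some direction, or a Taylor remainder.
  Continuity on the unit ball gives measurability, while \<open>C\<close> bounds \<open>m\<close> on
  the smaller ball only.\<close>

lemma cut_integrable_bound:
  assumes m: "continuous_on (ball 0 1) m"
    and C: "\<And>w. norm w < 1/2 \<Longrightarrow> cmod (m w) \<le> C" "0 \<le> C"
  shows "integrable (nu \<alpha>) (\<lambda>w. m w *\<^sub>C indicator (ball 0 (1/2)) w *\<^sub>R f w)" (is ?int)
    and "norm (LINT w|nu \<alpha>. m w *\<^sub>C indicator (ball 0 (1/2)) w *\<^sub>R f w) \<le> C * (LINT w|nu \<alpha>. norm (f w))"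
proof -
  have le: "norm (m w *\<^sub>C indicator (ball 0 (1/2)) w *\<^sub>R f w) \<le> C * norm (f w)" for w
    using C by (auto simp: norm_scaleC indicator_def intro!: mult_right_mono)
  have meas: "(\<lambda>w. m w *\<^sub>C indicator (ball 0 (1/2)) w *\<^sub>R f w) \<in> borel_measurable (nu \<alpha>)"
    by (intro borel_measurable_scaleC continuous_on_ball_imp_nu_measurable[OF m]
        borel_measurable_scaleR borel_measurable_indicator sub_ball_in_sets_nu
        borel_measurable_integrable[OF f])
  have intC: "integrable (nu \<alpha>) (\<lambda>w. C * norm (f w))"
    using f by (intro integrable_mult_right integrable_norm)
  show int: ?int
    using le C(2) by (intro Bochner_Integration.integrable_bound[OF intC meas]) auto
  have "norm (LINT w|nu \<alpha>. m w *\<^sub>C indicator (ball 0 (1/2)) w *\<^sub>R f w)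
      \<le> (LINT w|nu \<alpha>. norm (m w *\<^sub>C indicator (ball 0 (1/2)) w *\<^sub>R f w))"
    by (rule integral_norm_bound)
  also have "\<dots> \<le> (LINT w|nu \<alpha>. C * norm (f w))"
    using le by (intro integral_mono integrable_norm int intC)
  finally show "norm (LINT w|nu \<alpha>. m w *\<^sub>C indicator (ball 0 (1/2)) w *\<^sub>R f w)
      \<le> C * (LINT w|nu \<alpha>. norm (f w))" by simp
qed

lemma toeplitz_cut_eq:
  assumes "norm z < 1"
  shows "toeplitz_fun \<alpha> cut_symbol f z = (LINT w|nu \<alpha>.
    ker_deriv (real CARD('n) + 1 + \<alpha>) 0 (hdot z w) *\<^sub>C indicator (ball 0 (1/2)) w *\<^sub>R f w)"
  using assms unfolding toeplitz_fun_def
  by (auto intro!: Bochner_Integration.integral_cong simp: cut_symbol_apply cnj_kernelK)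

lemma toeplitz_cut_bound:
  assumes z: "norm z < 1"
  shows "norm (toeplitz_fun \<alpha> cut_symbol f z)
    \<le> 2 powr (real CARD('n) + 1 + \<alpha>) * (LINT w|nu \<alpha>. norm (f w))"
  unfolding toeplitz_cut_eq[OF z]
proof (rule cut_integrable_bound(2)[OF continuous_on_ker_hdot[OF z]])
  show "cmod (ker_deriv (real CARD('n) + 1 + \<alpha>) 0 (hdot z w)) \<le> 2 powr (real CARD('n) + 1 + \<alpha>)"
    if "norm w < 1/2" for w
    using ker_deriv_bound[OF _ cmod_hdot_le_half[OF z that], of "real CARD('n) + 1 + \<alpha>" 0] \<alpha> by simp
qed simp

text \<open>Subtracting the candidate derivative leaves the integral of the Taylor remainder
  \<open>R\<close>, which is of order |y - z|^2 uniformly on the support. This takes the place of a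
  theorem on differentiation under the integral.\<close>

lemma holomorphic_toeplitz_cut: "holomorphic_ball (toeplitz_fun \<alpha> cut_symbol f)"
  unfolding holomorphic_ball_def
proof
  fix z :: "complex ^ 'n" assume "z \<in> ball 0 1"
  then have z: "norm z < 1" by simp
  define s where "s = real CARD('n) + 1 + \<alpha>"
  have s: "0 \<le> s" using \<alpha> by (simp add: s_def)
  let ?F = "toeplitz_fun \<alpha> cut_symbol f"
  let ?g = "\<lambda>w. indicator (ball 0 (1/2)) w *\<^sub>R f w"
  \<comment> \<open>Formal differentiation under the integral: the chain rule produces the factor
    \<open>hdot h w\<close>, complex-linear in \<open>h\<close>.\<close>
  define L where "L h = (LINT w|nu \<alpha>. (ker_deriv s 1 (hdot z w) * hdot h w) *\<^sub>C ?g w)" for h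
  define I where "I = (LINT w|nu \<alpha>. norm (f w))"
  define C1 where "C1 = pochhammer s 1 * 2 powr (s + 1)"
  have C1: "0 \<le> C1" using s by (simp add: C1_def)
  define C2 where "C2 = pochhammer s 2 * 2 powr (s + 2)"
  have C2: "0 \<le> C2" using s by (simp add: C2_def numeral_2_eq_2 pochhammer_Suc)
  have hdh: "cmod (hdot h w) \<le> norm h" if "norm w < 1/2" for h w :: "complex ^ 'n"
    using cmod_hdot_le[of h w] that mult_left_le[of "norm w" "norm h"] by simp
  have cont: "continuous_on (ball 0 1) (\<lambda>w. ker_deriv s 1 (hdot z w) * hdot h w)" for h
    by (intro continuous_intros continuous_on_ker_hdot[OF z])
  have bd: "cmod (ker_deriv s 1 (hdot z w) * hdot h w) \<le> C1 * norm h" if "norm w < 1/2" for h w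
    using ker_deriv_bound[OF s cmod_hdot_le_half[OF z that], of 1] hdh[OF that, of h] C1
    by (simp add: norm_mult C1_def mult_mono)
  have Lint: "integrable (nu \<alpha>) (\<lambda>w. (ker_deriv s 1 (hdot z w) * hdot h w) *\<^sub>C ?g w)"
    and Lbd: "norm (L h) \<le> C1 * norm h * I" for h
    unfolding L_def I_def using C1
    by (intro cut_integrable_bound[OF cont bd]; simp)+
  have Llin: "bounded_linear L"
  proof (rule bounded_linear_intro)
    show "L (h + k) = L h + L k" for h k
      unfolding L_def by (subst Bochner_Integration.integral_add[symmetric, OF Lint Lint])
        (simp add: hdot_add_left ring_distribs scaleC.add_left)
    show "L (r *\<^sub>R h) = r *\<^sub>R L h" for r h
      unfolding L_def integral_scaleR_right[symmetric]
      by (simp add: hdot_scaleR_left scaleC.scaleR_left)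
    show "norm (L h) \<le> norm h * (C1 * I)" for h
      using Lbd[of h] by (simp add: mult_ac)
  qed
  have Lcomplex: "L (c *s h) = c *\<^sub>C L h" for c h
    unfolding L_def
    by (subst integral_bounded_linear[OF scaleC.bounded_linear_right Lint, symmetric])
       (simp add: hdot_scale_left scaleC_scaleC mult_ac)
  have "(?F has_derivative L) (at z)"
  proof (rule has_derivativeI_sandwich[of "1 - norm z"])
    show "0 < 1 - norm z" using z by simp
    show "bounded_linear L" by (rule Llin)
    fix y assume y: "y \<noteq> z" "dist y z < 1 - norm z"
    \<comment> \<open>The radius \<open>1 - norm z\<close> keeps \<open>y\<close> inside the unit
      ball, where the integral formula is valid.\<close>
    have y1: "norm y < 1"
      using y(2) norm_triangle_ineq2[of y z] by (simp add: dist_norm)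
    define R where "R w = ker_deriv s 0 (hdot y w) - ker_deriv s 0 (hdot z w)
      - ker_deriv s 1 (hdot z w) * hdot (y - z) w" for w
    have "continuous_on (ball 0 1) R"
      unfolding R_def by (intro continuous_intros continuous_on_ker_hdot y1 z)
    moreover have "cmod (R w) \<le> C2 * (norm (y - z))\<^sup>2" if w: "norm w < 1/2" for w
    proof -
      have "cmod (R w) \<le> C2 * (cmod (hdot y w - hdot z w))\<^sup>2"
        using ker_deriv_taylor[OF s cmod_hdot_le_half[OF z w] cmod_hdot_le_half[OF y1 w]]
        by (simp add: R_def C2_def hdot_diff_left)
      also have "\<dots> \<le> C2 * (norm (y - z))\<^sup>2"
        using hdh[OF w, of "y - z"] C2 by (intro mult_left_mono power_mono) (auto simp: hdot_diff_left)
      finally show ?thesis .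
    qed
    ultimately have "norm (LINT w|nu \<alpha>. R w *\<^sub>C ?g w) \<le> C2 * (norm (y - z))\<^sup>2 * I"
      unfolding I_def using C2 by (intro cut_integrable_bound(2)) auto
    also have "(LINT w|nu \<alpha>. R w *\<^sub>C ?g w) = ?F y - ?F z - L (y - z)"
    proof -
      have int0: "integrable (nu \<alpha>) (\<lambda>w. ker_deriv s 0 (hdot x w) *\<^sub>C ?g w)" if "norm x < 1" for x
        using ker_deriv_bound[OF s cmod_hdot_le_half[OF that], where i = 0]
        by (intro cut_integrable_bound(1)[where C = "2 powr s"] continuous_on_ker_hdot[OF that]) auto
      show ?thesis
        unfolding toeplitz_cut_eq[OF y1] toeplitz_cut_eq[OF z] s_def[symmetric] L_def R_def scaleC.diff_left
        by (simp only: Bochner_Integration.integral_diff Bochner_Integration.integrable_diff int0 y1 z Lint)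
    qed
    finally show "norm (?F y - ?F z - L (y - z)) / norm (y - z) \<le> C2 * I * norm (y - z)"
      using y(1) by (simp add: divide_le_eq power2_eq_square mult_ac)
  next
    have "((\<lambda>y. C2 * I * norm (y - z)) \<longlongrightarrow> C2 * I * norm (z - z)) (at z)"
      by (intro tendsto_intros)
    then show "((\<lambda>y. C2 * I * norm (y - z)) \<longlongrightarrow> 0) (at z)" by simp
  qed
  then show "\<exists>f'. (?F has_derivative f') (at z) \<and> (\<forall>c h. f' (c *s h) = c *\<^sub>C f' h)"
    using Lcomplex by blast
qed

end

section \<open>Bergman space and Berezin transform\<close>

lemma Lp_norm_2: "Lp_norm \<alpha> 2 f = sqrt (LINT z|nu \<alpha>. (norm (f z))\<^sup>2)"
  unfolding Lp_norm_def by (simp add: powr_half_sqrt)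

lemma holomorphic_ball_imp_continuous_on:
  "holomorphic_ball f \<Longrightarrow> continuous_on (ball 0 1) f"
  unfolding holomorphic_ball_def
  by (intro continuous_at_imp_continuous_on) (blast intro: has_derivative_continuous)

context
  fixes \<alpha> :: real
  assumes \<alpha>: "\<alpha> > -1"
begin

interpretation finite_measure "nu \<alpha> :: (complex ^ 'n) measure"
  by (rule finite_measure_nu[OF \<alpha>])

lemma integral_nu_const: "(LINT z|(nu \<alpha> :: (complex ^ 'n) measure). c) = (c :: real)"
  by (simp add: measure_nu_ball[OF \<alpha>])

lemma bergman_space_integrable_square:
  assumes f: "f \<in> bergman_space \<alpha>"
  shows "integrable (nu \<alpha>) (\<lambda>z. (norm (f z))\<^sup>2)"
proof -
  have meas [measurable]: "f \<in> borel_measurable (nu \<alpha>)"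
    using f by (auto simp: bergman_space_def intro: continuous_on_ball_imp_nu_measurable holomorphic_ball_imp_continuous_on)
  have "(\<integral>\<^sup>+z. ennreal (norm ((norm (f z))\<^sup>2)) \<partial>nu \<alpha>) < \<infinity>"
    using f by (simp add: bergman_space_def Lp_space_def)
  then show ?thesis by (intro integrableI_bounded) auto
qed

lemma bergman_space_integrable:
  fixes f :: "complex ^ 'n \<Rightarrow> ell2"
  assumes f: "f \<in> bergman_space \<alpha>"
  shows "integrable (nu \<alpha>) f"
proof (rule Bochner_Integration.integrable_bound)
  show "integrable (nu \<alpha>) (\<lambda>z. 1 + (norm (f z))\<^sup>2)"
    by (intro Bochner_Integration.integrable_add bergman_space_integrable_square[OF f] integrable_const)
  show "f \<in> borel_measurable (nu \<alpha>)"
    using f by (auto simp: bergman_space_def intro: continuous_on_ball_imp_nu_measurable holomorphic_ball_imp_continuous_on)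
  have "x \<le> 1 + x\<^sup>2" if "0 \<le> x" for x :: real
    using sum_squares_bound[of x 1] that by simp
  then show "AE z in nu \<alpha>. norm (f z) \<le> norm (1 + (norm (f z))\<^sup>2)"
    by (simp add: abs_of_nonneg)
qed

text \<open>The variance of \<open>norm (f z)\<close> under a probability measure is
  nonnegative.\<close>

lemma integral_norm_le_Lp_norm_2:
  fixes f :: "complex ^ 'n \<Rightarrow> ell2"
  assumes f: "f \<in> bergman_space \<alpha>"
  shows "(LINT z|nu \<alpha>. norm (f z)) \<le> Lp_norm \<alpha> 2 f"
proof -
  define m where "m = (LINT z|nu \<alpha>. norm (f z))"
  note int = bergman_space_integrable_square[OF f] integrable_norm[OF bergman_space_integrable[OF f]]
  have "0 \<le> (LINT z|nu \<alpha>. (norm (f z) - m)\<^sup>2)" by simp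
  also have "\<dots> = (LINT z|nu \<alpha>. (norm (f z))\<^sup>2 - 2 * m * norm (f z) + m\<^sup>2)"
    by (simp add: power2_diff algebra_simps)
  also have "\<dots> = (LINT z|nu \<alpha>. (norm (f z))\<^sup>2) - 2 * m * m + m\<^sup>2"
    using int by (simp add: measure_nu_ball[OF \<alpha>] m_def)
  finally have "m\<^sup>2 \<le> (LINT z|nu \<alpha>. (norm (f z))\<^sup>2)"
    by (simp add: power2_eq_square)
  then show ?thesis unfolding Lp_norm_2 m_def[symmetric] by (rule real_le_rsqrt)
qed

text \<open>Because the total mass is 1, a uniform bound is a bound for the norm with the same
  constant.\<close>

lemma bergman_space_if_bounded:
  fixes f :: "complex ^ 'n \<Rightarrow> ell2"
  assumes hol: "holomorphic_ball f" and B: "\<And>z. norm z < 1 \<Longrightarrow> norm (f z) \<le> B"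
    and 0: "\<And>z. \<not> norm z < 1 \<Longrightarrow> f z = 0"
  shows "f \<in> bergman_space \<alpha>" and "Lp_norm \<alpha> 2 f \<le> B"
proof -
  have meas: "f \<in> borel_measurable (nu \<alpha>)"
    by (intro continuous_on_ball_imp_nu_measurable holomorphic_ball_imp_continuous_on hol)
  have sq: "(norm (f z))\<^sup>2 \<le> B\<^sup>2" if "norm z < 1" for z
    using B[OF that] by (intro power_mono) auto
  have int: "integrable (nu \<alpha>) (\<lambda>z. (norm (f z))\<^sup>2)"
    by (rule integrable_const_bound[where B = "B\<^sup>2"])
       (use sq meas in auto)
  have "(\<integral>\<^sup>+z. ennreal (norm (f z) powr 2) \<partial>nu \<alpha>) < \<infinity>"
    using int by (simp add: integrable_iff_bounded)
  then show f: "f \<in> bergman_space \<alpha>"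
    using hol 0 strongly_measurable_if_borel[OF meas]
    by (simp add: bergman_space_def Lp_space_def)
  have "0 \<le> B" using B[of 0] norm_ge_zero[of "f 0"] by (simp del: norm_ge_zero)
  have "(LINT z|nu \<alpha>. (norm (f z))\<^sup>2) \<le> (LINT z|(nu \<alpha> :: (complex ^ 'n) measure). B\<^sup>2)"
    by (rule integral_mono[OF int integrable_const]) (use sq in auto)
  then show "Lp_norm \<alpha> 2 f \<le> B"
    unfolding Lp_norm_2 integral_nu_const using \<open>0 \<le> B\<close> by (rule real_le_lsqrt[rotated])
qed

text \<open>The image is even a bounded function: pointwise it is controlled by the L^1 norm of
  \<open>f\<close>, hence by its L^2 norm.\<close>

lemma toeplitz_cut_bergman:
  fixes f :: "complex ^ 'n \<Rightarrow> ell2"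
  assumes f: "f \<in> bergman_space \<alpha>"
  shows "toeplitz_fun \<alpha> cut_symbol f \<in> bergman_space \<alpha>"
    and "Lp_norm \<alpha> 2 (toeplitz_fun \<alpha> cut_symbol f) \<le> 2 powr (real CARD('n) + 1 + \<alpha>) * Lp_norm \<alpha> 2 f"
proof -
  note int = bergman_space_integrable[OF f]
  have bd: "norm (toeplitz_fun \<alpha> cut_symbol f z) \<le> 2 powr (real CARD('n) + 1 + \<alpha>) * Lp_norm \<alpha> 2 f"
    if "norm z < 1" for z
    by (rule order_trans[OF toeplitz_cut_bound[OF \<alpha> int that]])
       (intro mult_left_mono integral_norm_le_Lp_norm_2 f, simp)
  have 0: "toeplitz_fun \<alpha> cut_symbol f z = 0" if "\<not> norm z < 1" for z
    using that by (simp add: toeplitz_fun_def)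
  show "toeplitz_fun \<alpha> cut_symbol f \<in> bergman_space \<alpha>"
    "Lp_norm \<alpha> 2 (toeplitz_fun \<alpha> cut_symbol f) \<le> 2 powr (real CARD('n) + 1 + \<alpha>) * Lp_norm \<alpha> 2 f"
    using bergman_space_if_bounded[OF holomorphic_toeplitz_cut[OF \<alpha> int] bd 0] by blast+
qed

lemma bergman_op_toeplitz_cut:
  "bergman_op \<alpha> (toeplitz_fun \<alpha> cut_symbol :: 'n::finite ell2_fun \<Rightarrow> 'n ell2_fun)"
  unfolding bergman_op_def
proof (intro conjI ballI allI)
  have ker: "integrable (nu \<alpha>) (\<lambda>w. ker_deriv (real CARD('n) + 1 + \<alpha>) 0 (hdot z w) *\<^sub>C
      indicator (ball 0 (1/2)) w *\<^sub>R f w)"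
    if f: "f \<in> bergman_space \<alpha>" and z: "norm z < 1" for f and z :: "complex ^ 'n"
    using ker_deriv_bound[OF _ cmod_hdot_le_half[OF z], where i = 0 and s = "real CARD('n) + 1 + \<alpha>"] \<alpha>
    by (intro cut_integrable_bound(1)[where C = "2 powr (real CARD('n) + 1 + \<alpha>)"]
        continuous_on_ker_hdot[OF z] bergman_space_integrable[OF f]) auto
  fix f g :: "'n ell2_fun" and c :: complex
  assume f: "f \<in> bergman_space \<alpha>"
  show "toeplitz_fun \<alpha> cut_symbol f \<in> bergman_space \<alpha>" by (rule toeplitz_cut_bergman[OF f])
  show "toeplitz_fun \<alpha> cut_symbol (\<lambda>z. c *\<^sub>C f z) = (\<lambda>z. c *\<^sub>C toeplitz_fun \<alpha> cut_symbol f z)"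
  proof
    fix z :: "complex ^ 'n"
    note ints = bergman_space_integrable[OF f]
      integrable_bounded_linear[OF scaleC.bounded_linear_right[of c] bergman_space_integrable[OF f]]
    show "toeplitz_fun \<alpha> cut_symbol (\<lambda>z. c *\<^sub>C f z) z = c *\<^sub>C toeplitz_fun \<alpha> cut_symbol f z"
    proof (cases "norm z < 1")
      case True
      have "k *\<^sub>C r *\<^sub>R c *\<^sub>C x = c *\<^sub>C k *\<^sub>C r *\<^sub>R x" for k r x
        by (simp add: scaleC.scaleR_right scaleC_scaleC mult.commute)
      then show ?thesis
        unfolding toeplitz_cut_eq[OF \<alpha> ints(1) True] toeplitz_cut_eq[OF \<alpha> ints(2) True]
        by (simp only: integral_bounded_linear[OF scaleC.bounded_linear_right ker[OF f True], symmetric])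
    qed (simp add: toeplitz_fun_def scaleC.zero_right)
  qed
  assume g: "g \<in> bergman_space \<alpha>"
  show "toeplitz_fun \<alpha> cut_symbol (\<lambda>z. f z + g z)
      = (\<lambda>z. toeplitz_fun \<alpha> cut_symbol f z + toeplitz_fun \<alpha> cut_symbol g z)"
  proof
    fix z :: "complex ^ 'n"
    note ints = bergman_space_integrable[OF f] bergman_space_integrable[OF g]
    show "toeplitz_fun \<alpha> cut_symbol (\<lambda>z. f z + g z) z
        = toeplitz_fun \<alpha> cut_symbol f z + toeplitz_fun \<alpha> cut_symbol g z"
    proof (cases "norm z < 1")
      case True
      then show ?thesis
        unfolding toeplitz_cut_eq[OF \<alpha> ints(1) True] toeplitz_cut_eq[OF \<alpha> ints(2) True]
          toeplitz_cut_eq[OF \<alpha> Bochner_Integration.integrable_add[OF ints] True]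
        by (simp only: scaleR_add_right scaleC.add_right Bochner_Integration.integral_add ker f g)
    qed (simp add: toeplitz_fun_def)
  qed
next
  show "\<exists>C. \<forall>f\<in>bergman_space \<alpha>. Lp_norm \<alpha> 2 (toeplitz_fun \<alpha> cut_symbol (f :: 'n ell2_fun)) \<le> C * Lp_norm \<alpha> 2 f"
    using toeplitz_cut_bergman(2) by blast
qed

section \<open>Berezin transform and mean oscillation of the cut symbol\<close>

lemma kernelk_eq:
  "kernelk \<alpha> z w = of_real ((1 - (norm z)\<^sup>2) powr ((real CARD('n) + 1 + \<alpha>) / 2)) *
    ker_deriv (real CARD('n) + 1 + \<alpha>) 0 (hdot w (z :: complex ^ 'n))"
  by (simp add: kernelk_def ker_deriv_def)

lemma kernelk_bound:
  fixes z w :: "complex ^ 'n"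
  assumes z: "norm z < 1" and w: "norm w < 1/2"
  shows "cmod (kernelk \<alpha> z w) \<le> 2 powr (real CARD('n) + 1 + \<alpha>)"
proof -
  define s where "s = real CARD('n) + 1 + \<alpha>"
  have s: "0 \<le> s" using \<alpha> by (simp add: s_def)
  \<comment> \<open>\<open>kernelk\<close> contains \<open>hdot w z\<close>; conjugation moves the
    point of the small ball into the second slot, where \<open>cmod_hdot_le_half\<close> expects
    it.\<close>
  have "cmod (hdot w z) \<le> 1/2"
    using cmod_hdot_le_half[OF z w] cmod_hdot_le[of w z] by (metis cnj_hdot complex_mod_cnj)
  then have "cmod (ker_deriv s 0 (hdot w z)) \<le> 2 powr s"
    using ker_deriv_bound[OF s, of _ 0] by simp
  moreover have "(1 - (norm z)\<^sup>2) powr (s / 2) \<le> 1"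
    using z s by (intro powr_le1) (auto simp: abs_square_le_1)
  ultimately have "(1 - (norm z)\<^sup>2) powr (s / 2) * cmod (ker_deriv s 0 (hdot w z)) \<le> 1 * 2 powr s"
    by (intro mult_mono) auto
  then show ?thesis
    by (simp add: kernelk_eq norm_mult s_def)
qed

text \<open>The Berezin transform of the scalar indicator function, to which that of
  \<open>cut_symbol\<close> reduces.\<close>

definition berezin_cut :: "complex ^ 'n \<Rightarrow> real" where
  "berezin_cut z = (LINT w|nu \<alpha>. (cmod (kernelk \<alpha> z w))\<^sup>2 * indicator (ball 0 (1/2)) w)"

lemma berezin_integrand:
  fixes z :: "complex ^ 'n"
  assumes z: "norm z < 1"
  shows "(\<lambda>w. (cmod (kernelk \<alpha> z w))\<^sup>2 * indicator (ball 0 (1/2)) w) \<in> borel_measurable (nu \<alpha>)"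
    and "\<bar>(cmod (kernelk \<alpha> z w))\<^sup>2 * indicator (ball 0 (1/2)) w\<bar> \<le> (2 powr (real CARD('n) + 1 + \<alpha>))\<^sup>2"
    and "integrable (nu \<alpha>) (\<lambda>w. (cmod (kernelk \<alpha> z w))\<^sup>2 * indicator (ball 0 (1/2)) w)"
proof -
  have "continuous_on (ball 0 1) (\<lambda>w. (cmod (kernelk \<alpha> z w))\<^sup>2)"
    unfolding kernelk_eq using z
    by (intro continuous_intros continuous_on_compose2[OF continuous_on_ker_deriv])
       (auto intro: cmod_hdot_lt_1)
  then show meas: "(\<lambda>w. (cmod (kernelk \<alpha> z w))\<^sup>2 * indicator (ball 0 (1/2)) w) \<in> borel_measurable (nu \<alpha>)"
    by (intro borel_measurable_times borel_measurable_indicator sub_ball_in_sets_nu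
        continuous_on_ball_imp_nu_measurable)
  show bd: "\<bar>(cmod (kernelk \<alpha> z w))\<^sup>2 * indicator (ball 0 (1/2)) w\<bar> \<le> (2 powr (real CARD('n) + 1 + \<alpha>))\<^sup>2" for w
    using kernelk_bound[OF z, of w] by (auto simp: indicator_def intro!: power_mono)
  show "integrable (nu \<alpha>) (\<lambda>w. (cmod (kernelk \<alpha> z w))\<^sup>2 * indicator (ball 0 (1/2)) w)"
    using bd meas by (intro integrable_const_bound[where B = "(2 powr (real CARD('n) + 1 + \<alpha>))\<^sup>2"]) auto
qed

lemma berezin_cut_symbol:
  assumes z: "norm z < 1"
  shows "berezin \<alpha> cut_symbol z = berezin_cut z *\<^sub>R id_blinfun"
proof -
  have "has_bochner_integral (nu \<alpha>) (\<lambda>w. (cmod (kernelk \<alpha> z w))\<^sup>2 * indicator (ball 0 (1/2)) w) (berezin_cut z)"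
    unfolding berezin_cut_def using berezin_integrand(3)[OF z] by (rule has_bochner_integral_integrable)
  from strong_integral_scaleR_const[OF this, of "id_blinfun :: ell2 \<Rightarrow>\<^sub>L ell2"]
  show ?thesis unfolding berezin_def cut_symbol_def by simp
qed

lemma berezin_cut_bound:
  fixes z :: "complex ^ 'n"
  assumes z: "norm z < 1"
  shows "\<bar>berezin_cut z\<bar> \<le> (2 powr (real CARD('n) + 1 + \<alpha>))\<^sup>2"
proof -
  have "\<bar>berezin_cut z\<bar> \<le> (LINT w|nu \<alpha>. \<bar>(cmod (kernelk \<alpha> z w))\<^sup>2 * indicator (ball 0 (1/2)) w\<bar>)"
    unfolding berezin_cut_def by (rule integral_abs_bound)
  also have "\<dots> \<le> (LINT w|(nu \<alpha> :: (complex ^ 'n) measure). (2 powr (real CARD('n) + 1 + \<alpha>))\<^sup>2)"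
    by (intro integral_mono integrable_abs berezin_integrand[OF z] integrable_const)
  finally show ?thesis by (simp add: measure_nu_ball[OF \<alpha>])
qed

text \<open>Dominated convergence with a constant majorant. Continuity supplies the measurability of
  the Berezin transform.\<close>

lemma continuous_on_berezin_cut: "continuous_on (ball 0 1) (berezin_cut :: complex ^ 'n \<Rightarrow> real)"
  unfolding continuous_on_sequentially
proof (intro allI ballI impI, elim conjE)
  fix x and a :: "complex ^ 'n"
  assume a: "a \<in> ball 0 1" and x: "\<forall>n. x n \<in> ball 0 1" "x \<longlonglongrightarrow> a"
  show "(berezin_cut \<circ> x) \<longlonglongrightarrow> berezin_cut a"
    unfolding o_def berezin_cut_def
  proof (rule integral_dominated_convergence)
    show "(\<lambda>w. (cmod (kernelk \<alpha> a w))\<^sup>2 * indicator (ball 0 (1/2)) w) \<in> borel_measurable (nu \<alpha>)"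
      "(\<lambda>w. (cmod (kernelk \<alpha> (x i) w))\<^sup>2 * indicator (ball 0 (1/2)) w) \<in> borel_measurable (nu \<alpha>)"
      for i using a x(1) by (auto intro!: berezin_integrand)
    show "integrable (nu \<alpha>) (\<lambda>w :: complex ^ 'n. (2 powr (real CARD('n) + 1 + \<alpha>))\<^sup>2)"
      by (rule integrable_const)
    show "AE w in nu \<alpha>. norm ((cmod (kernelk \<alpha> (x i) w))\<^sup>2 * indicator (ball 0 (1/2)) w)
        \<le> (2 powr (real CARD('n) + 1 + \<alpha>))\<^sup>2" for i
      unfolding real_norm_def by (intro AE_I2 berezin_integrand(2)) (use x(1) in auto)
    show "AE w in nu \<alpha>. (\<lambda>i. (cmod (kernelk \<alpha> (x i) w))\<^sup>2 * indicator (ball 0 (1/2)) w)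
        \<longlonglongrightarrow> (cmod (kernelk \<alpha> a w))\<^sup>2 * indicator (ball 0 (1/2)) w"
    proof (intro AE_I2 tendsto_intros)
      fix w :: "complex ^ 'n" assume "w \<in> space (nu \<alpha>)"
      then have "continuous_on (ball 0 1) (\<lambda>z. kernelk \<alpha> z w)"
        unfolding kernelk_eq
        by (intro continuous_intros continuous_on_compose2[OF continuous_on_ker_deriv])
           (auto intro: cmod_hdot_lt_1 simp: abs_square_eq_1)
      then show "(\<lambda>i. kernelk \<alpha> (x i) w) \<longlonglongrightarrow> kernelk \<alpha> a w"
        using a x by (intro continuous_on_tendsto_compose[of "ball 0 1" "\<lambda>z. kernelk \<alpha> z w"]) auto
    qed
  qed
qed

lemma berezin_cut_symbol_Linf: "berezin \<alpha> (cut_symbol :: complex ^ 'n \<Rightarrow> _) \<in> Linf_space \<alpha>"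
proof -
  have "strongly_measurable (nu \<alpha>) (\<lambda>z :: complex ^ 'n. berezin_cut z *\<^sub>R (id_blinfun :: ell2 \<Rightarrow>\<^sub>L ell2))"
    by (intro strongly_measurable_scaleR_const continuous_on_ball_imp_nu_measurable continuous_on_berezin_cut)
  then have "strongly_measurable (nu \<alpha>) (berezin \<alpha> (cut_symbol :: complex ^ 'n \<Rightarrow> _))"
    by (rule strongly_measurable_cong[rotated]) (simp add: berezin_cut_symbol)
  moreover have "AE z in nu \<alpha>. norm (berezin \<alpha> (cut_symbol :: complex ^ 'n \<Rightarrow> _) z)
      \<le> (2 powr (real CARD('n) + 1 + \<alpha>))\<^sup>2 * norm (id_blinfun :: ell2 \<Rightarrow>\<^sub>L ell2)"
    by (rule AE_I2) (auto simp: berezin_cut_symbol intro!: mult_right_mono berezin_cut_bound)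
  ultimately show ?thesis unfolding Linf_space_def by blast
qed

lemma nn_integral_nu_const: "(\<integral>\<^sup>+z. c \<partial>(nu \<alpha> :: (complex ^ 'n) measure)) = c"
  by (simp add: emeasure_nu_ball[OF \<alpha>])

text \<open>Boundedness suffices: the integrand is at most \<open>?K + ?D * ?K\<close> at every w,
  wherever \<open>ball_aut z\<close> sends it, and the total mass is 1.\<close>

lemma cut_symbol_BMO1: "(cut_symbol :: complex ^ 'n \<Rightarrow> _) \<in> BMO1 \<alpha>"
proof -
  let ?K = "norm (id_blinfun :: ell2 \<Rightarrow>\<^sub>L ell2)" and ?D = "(2 powr (real CARD('n) + 1 + \<alpha>))\<^sup>2"
  have cut: "norm (cut_symbol w) \<le> ?K" for w :: "complex ^ 'n"
    by (simp add: cut_symbol_def indicator_def)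
  have "strongly_measurable (nu \<alpha>) (cut_symbol :: complex ^ 'n \<Rightarrow> _)"
    unfolding cut_symbol_def[abs_def]
    by (intro strongly_measurable_scaleR_const borel_measurable_indicator sub_ball_in_sets_nu)
  moreover have "(\<integral>\<^sup>+z. ennreal (norm (cut_symbol z) powr 1) \<partial>(nu \<alpha> :: (complex ^ 'n) measure)) < \<infinity>"
  proof -
    have "(\<integral>\<^sup>+z. ennreal (norm (cut_symbol z) powr 1) \<partial>(nu \<alpha> :: (complex ^ 'n) measure))
      \<le> (\<integral>\<^sup>+z. ennreal ?K \<partial>(nu \<alpha> :: (complex ^ 'n) measure))"
      using cut by (intro nn_integral_mono ennreal_leI) simp
    then show ?thesis unfolding nn_integral_nu_const by (auto intro: le_less_trans)
  qed
  moreover have "(SUP z\<in>ball 0 1. \<integral>\<^sup>+w. ennreal (norm (cut_symbol (ball_aut z w) - berezin \<alpha> cut_symbol z))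
      \<partial>(nu \<alpha> :: (complex ^ 'n) measure)) \<le> ennreal (?K + ?D * ?K)"
  proof (rule SUP_least)
    fix z :: "complex ^ 'n" assume "z \<in> ball 0 1"
    then have "norm (berezin \<alpha> cut_symbol z) \<le> ?D * ?K"
      by (auto simp: berezin_cut_symbol intro!: mult_right_mono berezin_cut_bound)
    then have "norm (cut_symbol (ball_aut z w) - berezin \<alpha> cut_symbol z) \<le> ?K + ?D * ?K" for w
      using norm_triangle_ineq4[of "cut_symbol (ball_aut z w)" "berezin \<alpha> cut_symbol z"]
        cut[of "ball_aut z w"] by linarith
    then have "(\<integral>\<^sup>+w. ennreal (norm (cut_symbol (ball_aut z w) - berezin \<alpha> cut_symbol z)) \<partial>nu \<alpha>)
      \<le> (\<integral>\<^sup>+w. ennreal (?K + ?D * ?K) \<partial>(nu \<alpha> :: (complex ^ 'n) measure))"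
      by (intro nn_integral_mono ennreal_leI)
    then show "(\<integral>\<^sup>+w. ennreal (norm (cut_symbol (ball_aut z w) - berezin \<alpha> cut_symbol z)) \<partial>nu \<alpha>)
      \<le> ennreal (?K + ?D * ?K)" unfolding nn_integral_nu_const .
  qed
  ultimately show ?thesis
    unfolding BMO1_def Lp_space_def by (auto intro: le_less_trans)
qed

end

lemma cut_symbol_L_ell2: "cut_symbol z \<in> L_ell2"
  by (simp add: L_ell2_def cut_symbol_apply scaleC.scaleR_right)

section \<open>Distance from the Toeplitz algebra\<close>

lemma holomorphic_ball_const: "holomorphic_ball (\<lambda>z :: complex ^ 'n. if z \<in> ball 0 1 then x else 0)"
  unfolding holomorphic_ball_def
proof
  fix z :: "complex ^ 'n" assume "z \<in> ball 0 1"
  then have "((\<lambda>z. if z \<in> ball 0 1 then x else 0) has_derivative (\<lambda>_. 0)) (at z)"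
    by (intro has_derivative_transform_within_open[OF has_derivative_const[of x] _ _, where s = "ball 0 1"]) auto
  then show "\<exists>f'. ((\<lambda>z. if z \<in> ball 0 1 then x else 0) has_derivative f') (at z) \<and>
      (\<forall>c h. f' (c *s h) = c *\<^sub>C f' h)"
    by (intro exI[of _ "\<lambda>_. 0"]) (simp add: scaleC.zero_right)
qed

lemma holomorphic_ball_add:
  fixes f g :: "complex ^ 'n \<Rightarrow> ell2"
  assumes "holomorphic_ball f" "holomorphic_ball g"
  shows "holomorphic_ball (\<lambda>z. f z + g z)"
  unfolding holomorphic_ball_def
proof
  fix z :: "complex ^ 'n" assume "z \<in> ball 0 1"
  then obtain f' g' where "(f has_derivative f') (at z)" "\<forall>c h. f' (c *s h) = c *\<^sub>C f' h"
    "(g has_derivative g') (at z)" "\<forall>c h. g' (c *s h) = c *\<^sub>C g' h"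
    using assms unfolding holomorphic_ball_def by meson
  then show "\<exists>f'. ((\<lambda>z. f z + g z) has_derivative f') (at z) \<and> (\<forall>c h. f' (c *s h) = c *\<^sub>C f' h)"
    by (intro exI[of _ "\<lambda>h. f' h + g' h"]) (auto intro: has_derivative_add simp: scaleC.add_right)
qed

text \<open>The mapping property together with a norm bound passes through compositions and sums,
  and it makes the set defining an operator norm bounded above. Requiring \<open>C \<ge> 0\<close>
  allows bounds to be multiplied.\<close>

definition bergman_bounded :: "real \<Rightarrow> ('n::finite ell2_fun \<Rightarrow> 'n ell2_fun) \<Rightarrow> bool" where
  "bergman_bounded \<alpha> S \<longleftrightarrow> (\<exists>C\<ge>0. \<forall>f\<in>bergman_space \<alpha>. S f \<in> bergman_space \<alpha> \<and> Lp_norm \<alpha> 2 (S f) \<le> C * Lp_norm \<alpha> 2 f)"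

lemma Lp_norm_nonneg: "0 \<le> Lp_norm \<alpha> p f"
  by (simp add: Lp_norm_def)

lemma bergman_op_imp_bounded: "bergman_op \<alpha> S \<Longrightarrow> bergman_bounded \<alpha> S"
proof -
  assume S: "bergman_op \<alpha> S"
  then obtain C where C: "\<forall>f\<in>bergman_space \<alpha>. Lp_norm \<alpha> 2 (S f) \<le> C * Lp_norm \<alpha> 2 f"
    unfolding bergman_op_def by blast
  have "Lp_norm \<alpha> 2 (S f) \<le> \<bar>C\<bar> * Lp_norm \<alpha> 2 f" if "f \<in> bergman_space \<alpha>" for f
    using C that mult_right_mono[OF abs_ge_self[of C] Lp_norm_nonneg[of \<alpha> 2 f]] by force
  then show ?thesis
    using S unfolding bergman_bounded_def bergman_op_def by (intro exI[of _ "\<bar>C\<bar>"]) auto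
qed

lemma bergman_bounded_comp:
  assumes "bergman_bounded \<alpha> S" "bergman_bounded \<alpha> R"
  shows "bergman_bounded \<alpha> (S \<circ> R)"
proof -
  obtain C D where C: "C \<ge> 0" "\<forall>f\<in>bergman_space \<alpha>. S f \<in> bergman_space \<alpha> \<and> Lp_norm \<alpha> 2 (S f) \<le> C * Lp_norm \<alpha> 2 f"
    and D: "D \<ge> 0" "\<forall>f\<in>bergman_space \<alpha>. R f \<in> bergman_space \<alpha> \<and> Lp_norm \<alpha> 2 (R f) \<le> D * Lp_norm \<alpha> 2 f"
    using assms unfolding bergman_bounded_def by blast
  have "Lp_norm \<alpha> 2 (S (R f)) \<le> (C * D) * Lp_norm \<alpha> 2 f" if f: "f \<in> bergman_space \<alpha>" for f
  proof -
    have "Lp_norm \<alpha> 2 (S (R f)) \<le> C * Lp_norm \<alpha> 2 (R f)" using C D f by blast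
    also have "\<dots> \<le> C * (D * Lp_norm \<alpha> 2 f)" using C(1) D f by (intro mult_left_mono) auto
    finally show ?thesis by (simp add: mult.assoc)
  qed
  then show ?thesis
    unfolding bergman_bounded_def using C D by (intro exI[of _ "C * D"]) auto
qed

lemma bergman_bounded_id: "bergman_bounded \<alpha> (\<lambda>f. f)"
  unfolding bergman_bounded_def by (intro exI[of _ 1]) simp

lemma bergman_bounded_op_prod:
  assumes "\<And>j. j \<in> {1..J} \<Longrightarrow> bergman_bounded \<alpha> (T j)"
  shows "bergman_bounded \<alpha> (op_prod J T)"
proof -
  \<comment> \<open>Stated for all lists of admissible indices, so that the induction may drop the
    head of the list.\<close>
  have "bergman_bounded \<alpha> (foldr (\<circ>) (map T js) id)" if "set js \<subseteq> {1..J}" for js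
    using that
  proof (induction js)
    case Nil
    then show ?case by (simp add: bergman_bounded_id id_def)
  next
    case (Cons j js)
    have "bergman_bounded \<alpha> (foldr (\<circ>) (map T js) id)"
      by (rule Cons.IH) (use Cons.prems in auto)
    moreover have "bergman_bounded \<alpha> (T j)"
      by (rule assms) (use Cons.prems in auto)
    moreover have "foldr (\<circ>) (map T (j # js)) id = T j \<circ> foldr (\<circ>) (map T js) id"
      by simp
    ultimately show ?case
      by (simp only: bergman_bounded_comp)
  qed
  then show ?thesis unfolding op_prod_def by (simp only: set_upt atLeastLessThanSuc_atLeastAtMost subset_refl)
qed

text \<open>A crude Minkowski inequality from (a + b)^2 <= 2a^2 + 2b^2; the factor 2 is harmless, as
  it enters only into finiteness of suprema and existence of bounds.\<close>

lemma Lp_norm_2_le_if_norm_le_add: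
  assumes fg: "integrable (nu \<alpha>) (\<lambda>z. (norm (f z))\<^sup>2)" "integrable (nu \<alpha>) (\<lambda>z. (norm (g z))\<^sup>2)"
    and h: "\<And>z. norm (h z) \<le> norm (f z) + norm (g z)"
  shows "Lp_norm \<alpha> 2 h \<le> 2 * (Lp_norm \<alpha> 2 f + Lp_norm \<alpha> 2 g)"
proof -
  have sq: "(norm (h z))\<^sup>2 \<le> 2 * (norm (f z))\<^sup>2 + 2 * (norm (g z))\<^sup>2" for z
  proof -
    have "(norm (h z))\<^sup>2 \<le> (norm (f z) + norm (g z))\<^sup>2" using h by (intro power_mono) auto
    then show ?thesis
      using sum_squares_bound[of "norm (f z)" "norm (g z)"] by (simp add: power2_sum)
  qed
  let ?F = "LINT z|nu \<alpha>. (norm (f z))\<^sup>2" and ?G = "LINT z|nu \<alpha>. (norm (g z))\<^sup>2"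
  have FG: "0 \<le> ?F" "0 \<le> ?G" by simp_all
  \<comment> \<open>\<open>integral_mono'\<close> asks for an integrable nonnegative majorant. If
    the left integrand is not integrable, its integral is 0 by convention.\<close>
  have "(LINT z|nu \<alpha>. (norm (h z))\<^sup>2) \<le> (LINT z|nu \<alpha>. 2 * (norm (f z))\<^sup>2 + 2 * (norm (g z))\<^sup>2)"
    using sq fg by (intro integral_mono') auto
  also have "\<dots> = 2 * ?F + 2 * ?G" using fg by simp
  also have "\<dots> \<le> (2 * (sqrt ?F + sqrt ?G))\<^sup>2"
    using FG real_sqrt_ge_zero[OF FG(1)] real_sqrt_ge_zero[OF FG(2)]
    by (simp add: power_mult_distrib power2_sum)
  finally show ?thesis
    unfolding Lp_norm_2 using FG by (intro real_le_lsqrt) auto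
qed

context
  fixes \<alpha> :: real
  assumes \<alpha>: "\<alpha> > -1"
begin

lemma const_in_bergman_space:
  "(\<lambda>z :: complex ^ 'n. if z \<in> ball 0 1 then x else 0) \<in> bergman_space \<alpha>"
  "Lp_norm \<alpha> 2 (\<lambda>z :: complex ^ 'n. if z \<in> ball 0 1 then x else 0) \<le> norm x"
proof -
  have "norm (if z \<in> ball 0 1 then x else 0) \<le> norm x" for z :: "complex ^ 'n" by simp
  from bergman_space_if_bounded[OF \<alpha> holomorphic_ball_const this]
  show "(\<lambda>z :: complex ^ 'n. if z \<in> ball 0 1 then x else 0) \<in> bergman_space \<alpha>"
    "Lp_norm \<alpha> 2 (\<lambda>z :: complex ^ 'n. if z \<in> ball 0 1 then x else 0) \<le> norm x"
    by auto
qed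

lemma bergman_space_add:
  fixes f g :: "complex ^ 'n \<Rightarrow> ell2"
  assumes f: "f \<in> bergman_space \<alpha>" and g: "g \<in> bergman_space \<alpha>"
  shows "(\<lambda>z. f z + g z) \<in> bergman_space \<alpha>"
proof -
  have hol: "holomorphic_ball (\<lambda>z. f z + g z)"
    using f g by (auto simp: bergman_space_def intro: holomorphic_ball_add)
  have meas: "(\<lambda>z. f z + g z) \<in> borel_measurable (nu \<alpha>)"
    by (intro continuous_on_ball_imp_nu_measurable holomorphic_ball_imp_continuous_on hol)
  note sq = bergman_space_integrable_square[OF \<alpha> f] bergman_space_integrable_square[OF \<alpha> g]
  have "integrable (nu \<alpha>) (\<lambda>z. (norm (f z + g z))\<^sup>2)"
  proof (rule Bochner_Integration.integrable_bound)
    show "integrable (nu \<alpha>) (\<lambda>z. 2 * (norm (f z))\<^sup>2 + 2 * (norm (g z))\<^sup>2)"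
      using sq by (intro Bochner_Integration.integrable_add integrable_mult_right)
    show "(\<lambda>z. (norm (f z + g z))\<^sup>2) \<in> borel_measurable (nu \<alpha>)"
      by (intro borel_measurable_power measurable_compose[OF meas borel_measurable_norm])
    have "(norm (f z + g z))\<^sup>2 \<le> 2 * (norm (f z))\<^sup>2 + 2 * (norm (g z))\<^sup>2" for z
    proof -
      have "(norm (f z + g z))\<^sup>2 \<le> (norm (f z) + norm (g z))\<^sup>2"
        by (intro power_mono norm_triangle_ineq) auto
      then show ?thesis
        using sum_squares_bound[of "norm (f z)" "norm (g z)"] by (simp add: power2_sum)
    qed
    then show "AE z in nu \<alpha>. norm ((norm (f z + g z))\<^sup>2) \<le> norm (2 * (norm (f z))\<^sup>2 + 2 * (norm (g z))\<^sup>2)"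
      by (intro AE_I2) (simp add: abs_of_nonneg)
  qed
  then have "(\<integral>\<^sup>+z. ennreal (norm (f z + g z) powr 2) \<partial>nu \<alpha>) < \<infinity>"
    by (simp add: integrable_iff_bounded)
  then show ?thesis
    using hol f g strongly_measurable_if_borel[OF meas] by (auto simp: bergman_space_def Lp_space_def)
qed

lemma bergman_bounded_add:
  assumes S: "bergman_bounded \<alpha> (S :: 'n::finite ell2_fun \<Rightarrow> 'n ell2_fun)" and R: "bergman_bounded \<alpha> R"
  shows "bergman_bounded \<alpha> (\<lambda>f z. S f z + R f z)"
proof -
  obtain C D where C: "C \<ge> 0" "\<forall>f\<in>bergman_space \<alpha>. S f \<in> bergman_space \<alpha> \<and> Lp_norm \<alpha> 2 (S f) \<le> C * Lp_norm \<alpha> 2 f"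
    and D: "D \<ge> 0" "\<forall>f\<in>bergman_space \<alpha>. R f \<in> bergman_space \<alpha> \<and> Lp_norm \<alpha> 2 (R f) \<le> D * Lp_norm \<alpha> 2 f"
    using assms unfolding bergman_bounded_def by blast
  have "(\<lambda>z. S f z + R f z) \<in> bergman_space \<alpha> \<and>
      Lp_norm \<alpha> 2 (\<lambda>z. S f z + R f z) \<le> (2 * (C + D)) * Lp_norm \<alpha> 2 f" if f: "f \<in> bergman_space \<alpha>" for f
  proof
    have SR: "S f \<in> bergman_space \<alpha>" "R f \<in> bergman_space \<alpha>" using C D f by auto
    then show "(\<lambda>z. S f z + R f z) \<in> bergman_space \<alpha>" by (rule bergman_space_add)
    have "Lp_norm \<alpha> 2 (\<lambda>z. S f z + R f z) \<le> 2 * (Lp_norm \<alpha> 2 (S f) + Lp_norm \<alpha> 2 (R f))"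
      by (intro Lp_norm_2_le_if_norm_le_add bergman_space_integrable_square[OF \<alpha>] SR norm_triangle_ineq)
    also have "\<dots> \<le> 2 * (C * Lp_norm \<alpha> 2 f + D * Lp_norm \<alpha> 2 f)"
      using C(2) D(2) f by (intro mult_left_mono add_mono) auto
    finally show "Lp_norm \<alpha> 2 (\<lambda>z. S f z + R f z) \<le> (2 * (C + D)) * Lp_norm \<alpha> 2 f"
      by (simp add: algebra_simps)
  qed
  then show ?thesis
    unfolding bergman_bounded_def using C D by (intro exI[of _ "2 * (C + D)"]) auto
qed

lemma bergman_bounded_sum:
  fixes L :: nat
  assumes "\<And>l. l \<in> {1..L} \<Longrightarrow> bergman_bounded \<alpha> (S l :: 'n::finite ell2_fun \<Rightarrow> 'n ell2_fun)"
  shows "bergman_bounded \<alpha> (\<lambda>f z. \<Sum>l=1..L. S l f z)"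
  using assms
proof (induction L)
  case 0
  have "(\<lambda>z :: complex ^ 'n. 0 :: ell2) \<in> bergman_space \<alpha>" "Lp_norm \<alpha> 2 (\<lambda>z :: complex ^ 'n. 0 :: ell2) = 0"
    using const_in_bergman_space(1)[where x = 0 and 'n = 'n] by (simp_all add: Lp_norm_2)
  then show ?case unfolding bergman_bounded_def by (intro exI[of _ 0]) simp
next
  case (Suc L)
  then have "bergman_bounded \<alpha> (\<lambda>f z. (\<Sum>l=1..L. S l f z) + S (Suc L) f z)"
    by (intro bergman_bounded_add) auto
  then show ?case by simp
qed

lemma bergman_bounded_toeplitz_poly:
  assumes "S \<in> toeplitz_poly \<alpha> e"
  shows "bergman_bounded \<alpha> (S :: 'n::finite ell2_fun \<Rightarrow> 'n ell2_fun)"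
proof -
  obtain J and L :: nat and T where S: "S = (\<lambda>f z. \<Sum>l=1..L. op_prod J (\<lambda>j. T j l) f z)"
    and T: "\<forall>j\<in>{1..J}. \<forall>l\<in>{1..L}. \<exists>u\<in>Linf_fin e. is_toeplitz_op \<alpha> u (T j l)"
    using assms unfolding toeplitz_poly_def mem_Collect_eq by blast
  have "bergman_bounded \<alpha> (T j l)" if "j \<in> {1..J}" "l \<in> {1..L}" for j l
    using T that bergman_op_imp_bounded unfolding is_toeplitz_op_def by blast
  then show ?thesis
    unfolding S by (intro bergman_bounded_sum bergman_bounded_op_prod)
qed

text \<open>Homogeneity at the scalar 0. It carries the zero function through the remaining factors
  of a product.\<close>

lemma bergman_op_zero:
  assumes "bergman_op \<alpha> (S :: 'n::finite ell2_fun \<Rightarrow> 'n ell2_fun)"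
  shows "S (\<lambda>z. 0) = (\<lambda>z. 0)"
proof -
  have zero: "(\<lambda>z :: complex ^ 'n. 0 :: ell2) \<in> bergman_space \<alpha>"
    using const_in_bergman_space(1)[where x = 0 and 'n = 'n] by simp
  have hom: "\<forall>c. \<forall>f\<in>bergman_space \<alpha>. S (\<lambda>z. c *\<^sub>C f z) = (\<lambda>z. c *\<^sub>C S f z)"
    using assms unfolding bergman_op_def by (elim conjE)
  have "S (\<lambda>z. 0 *\<^sub>C 0) = (\<lambda>z. 0 *\<^sub>C S (\<lambda>z. 0) z)"
    by (rule bspec[OF spec[OF hom] zero])
  then show ?thesis by (simp add: scaleC.zero_left)
qed

end

text \<open>The factor with index J is rightmost and acts first; \<open>1 \<le> J\<close> guarantees
  that it exists. Its value z is a common fixed point of all factors, so the others leave it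
  unchanged.\<close>

lemma op_prod_eq_zero:
  assumes J: "1 \<le> J" and 0: "T J f = z" and T: "\<And>j. j \<in> {1..J} \<Longrightarrow> T j z = z"
  shows "op_prod J T f = z"
proof -
  \<comment> \<open>Moves the factor applied first out of the fold and onto the argument.\<close>
  have comp: "foldr (\<circ>) xs g f = foldr (\<circ>) xs id (g f)" for xs and g :: "_ \<Rightarrow> _"
    by (induction xs) auto
  have fixed: "foldr (\<circ>) (map T js) id z = z" if "set js \<subseteq> {1..J}" for js
    using that T by (induction js) auto
  have "op_prod J T f = foldr (\<circ>) (map T [1..<J]) id (T J f)"
    using J comp[of "map T [1..<J]" "T J"] by (simp add: op_prod_def)
  also have "\<dots> = z" unfolding 0 by (rule fixed) auto
  finally show ?thesis .
qed

text \<open>For N outside the finite set of first indices, all coefficients of \<open>u z\<close>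
  applied to \<open>e N\<close> vanish, so totality of the basis applies. The index set already
  ranges over all z, which makes the choice of N uniform in z.\<close>

lemma Linf_fin_eventually_zero:
  assumes e: "ell2_orthonormal_basis e" and u: "u \<in> Linf_fin e"
  shows "\<forall>\<^sub>F N in sequentially. \<forall>z\<in>ball 0 1. blinfun_apply (u z) (e N) = 0"
proof -
  let ?A = "{(j, k). \<exists>z\<in>ball 0 1. cinner_ell2 (blinfun_apply (u z) (e j)) (e k) \<noteq> 0}"
  have "finite (fst ` ?A)" using u by (simp add: Linf_fin_def)
  then have "\<forall>\<^sub>F N in sequentially. N \<notin> fst ` ?A"
    by (simp add: cofinite_eq_sequentially[symmetric] eventually_cofinite)
  then show ?thesis
  proof eventually_elim
    case (elim N)
    have "cinner_ell2 (blinfun_apply (u z) (e N)) (e k) = 0" if "z \<in> ball 0 1" for z k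
    proof (rule ccontr)
      assume "cinner_ell2 (blinfun_apply (u z) (e N)) (e k) \<noteq> 0"
      then have "(N, k) \<in> ?A" using that by blast
      then have "fst (N, k) \<in> fst ` ?A" by (rule imageI)
      then show False using elim by simp
    qed
    then show ?case using orthonormal_basis_total[OF e] by blast
  qed
qed

section \<open>Images of constant functions and the distance estimate\<close>

definition const_ball :: "ell2 \<Rightarrow> 'n::finite ell2_fun" where
  "const_ball x = (\<lambda>z. if z \<in> ball 0 1 then x else 0)"

lemma const_ball_Hinf: "const_ball x \<in> Hinf_space"
proof -
  have "bounded (const_ball x ` ball 0 1)"
    by (rule finite_imp_bounded, rule finite_subset[of _ "{x}"]) (auto simp: const_ball_def)
  moreover have "holomorphic_ball (const_ball x)"
    unfolding const_ball_def by (rule holomorphic_ball_const)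
  moreover have "\<forall>z. z \<notin> ball 0 1 \<longrightarrow> const_ball x z = 0"
    by (simp add: const_ball_def)
  ultimately show ?thesis unfolding Hinf_space_def by blast
qed

text \<open>Constants lie in \<open>Hinf_space\<close>, so the first-acting factors
  \<open>T J l\<close> are given on them by the integral formula, whose integrand vanishes for large
  N. One N serves all summands because there are finitely many.\<close>

lemma toeplitz_poly_const_ball_zero:
  assumes \<alpha>: "\<alpha> > -1" and e: "ell2_orthonormal_basis e" and S: "S \<in> toeplitz_poly \<alpha> e"
  shows "\<exists>N. S (const_ball (e N)) = (\<lambda>z :: complex ^ 'n. 0)"
proof -
  obtain J and L :: nat and T where S: "S = (\<lambda>f z. \<Sum>l=1..L. op_prod J (\<lambda>j. T j l) f z)"
    and J: "1 \<le> J"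
    and T: "\<forall>j\<in>{1..J}. \<forall>l\<in>{1..L}. \<exists>u\<in>Linf_fin e. is_toeplitz_op \<alpha> u (T j l)"
    using S unfolding toeplitz_poly_def mem_Collect_eq by blast
  have "\<forall>\<^sub>F N in sequentially. T J l (const_ball (e N)) = (\<lambda>z. 0)" if l: "l \<in> {1..L}" for l
  proof -
    obtain u where u: "u \<in> Linf_fin e" "is_toeplitz_op \<alpha> u (T J l)"
      using bspec[OF bspec[OF T, of J] l] J by auto
    show ?thesis
      using Linf_fin_eventually_zero[OF e u(1)]
    proof eventually_elim
      case (elim N)
      have "toeplitz_fun \<alpha> u (const_ball (e N)) z = 0" for z :: "complex ^ 'n"
      proof -
        have "(LINT w|nu \<alpha>. cnj (kernelK \<alpha> z w) *\<^sub>C blinfun_apply (u w) (const_ball (e N) w))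
            = (LINT w|(nu \<alpha> :: (complex ^ 'n) measure). 0)"
          by (rule Bochner_Integration.integral_cong)
             (use elim in \<open>auto simp: const_ball_def scaleC.zero_right\<close>)
        then show ?thesis by (simp add: toeplitz_fun_def)
      qed
      moreover have "T J l (const_ball (e N)) = toeplitz_fun \<alpha> u (const_ball (e N))"
        using u(2) unfolding is_toeplitz_op_def by (elim conjE bspec) (rule const_ball_Hinf)
      ultimately show ?case by (simp add: fun_eq_iff)
    qed
  qed
  then have "\<forall>\<^sub>F N in sequentially. \<forall>l\<in>{1..L}. T J l (const_ball (e N)) = (\<lambda>z. 0)"
    by (intro eventually_ball_finite) auto
  then obtain N where N: "\<forall>l\<in>{1..L}. T J l (const_ball (e N)) = (\<lambda>z. 0)"
    using eventually_happens'[OF sequentially_bot] by blast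
  have "op_prod J (\<lambda>j. T j l) (const_ball (e N)) = (\<lambda>z. 0)" if l: "l \<in> {1..L}" for l
  proof (rule op_prod_eq_zero[OF J])
    show "T J l (const_ball (e N)) = (\<lambda>z. 0)" using N l by blast
    show "T j l (\<lambda>z. 0) = (\<lambda>z. 0)" if "j \<in> {1..J}" for j
      using T that l bergman_op_zero[OF \<alpha>] unfolding is_toeplitz_op_def by blast
  qed
  then show ?thesis unfolding S by (intro exI[of _ N]) simp
qed

text \<open>The scalar factor does not involve \<open>x\<close>, so all unit vectors have images of
  the same pointwise norm.\<close>

lemma toeplitz_cut_const_ball:
  fixes z :: "complex ^ 'n"
  assumes \<alpha>: "\<alpha> > -1" and z: "norm z < 1"
  shows "toeplitz_fun \<alpha> cut_symbol (const_ball x) z =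
    (LINT w|nu \<alpha>. ker_deriv (real CARD('n) + 1 + \<alpha>) 0 (hdot z w) * indicator (ball 0 (1/2)) w) *\<^sub>C x"
proof -
  define s where "s = real CARD('n) + 1 + \<alpha>"
  have s: "0 \<le> s" using \<alpha> by (simp add: s_def)
  interpret finite_measure "nu \<alpha> :: (complex ^ 'n) measure" by (rule finite_measure_nu[OF \<alpha>])
  have int: "integrable (nu \<alpha>) (\<lambda>w. ker_deriv s 0 (hdot z w) * indicator (ball 0 (1/2)) w)"
  proof (rule integrable_const_bound[where B = "2 powr s"])
    show "(\<lambda>w. ker_deriv s 0 (hdot z w) * indicator (ball 0 (1/2)) w) \<in> borel_measurable (nu \<alpha>)"
      by (intro borel_measurable_times borel_measurable_indicator sub_ball_in_sets_nu
          continuous_on_ball_imp_nu_measurable continuous_on_ker_hdot z)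
    show "AE w in nu \<alpha>. cmod (ker_deriv s 0 (hdot z w) * indicator (ball 0 (1/2)) w) \<le> 2 powr s"
      using ker_deriv_bound[OF s cmod_hdot_le_half[OF z], where i = 0]
      by (intro AE_I2) (auto simp: indicator_def norm_mult)
  qed
  have f: "integrable (nu \<alpha>) (const_ball x :: 'n ell2_fun)"
    using bergman_space_integrable[OF \<alpha> const_in_bergman_space(1)[OF \<alpha>]] by (simp add: const_ball_def)
  show ?thesis
    unfolding toeplitz_cut_eq[OF \<alpha> f z] s_def[symmetric]
    by (subst integral_bounded_linear[OF scaleC.bounded_linear_left int, symmetric])
       (rule Bochner_Integration.integral_cong,
        auto simp: const_ball_def indicator_def scaleC.zero_right scaleC.zero_left)
qed

text \<open>Norm 0 would force the continuous image to vanish throughout the ball. At the centre the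
  kernel equals 1, so the image there is \<open>x\<close> times the measure of the small ball, which
  is positive.\<close>

lemma Lp_norm_toeplitz_cut_const_ball_pos:
  assumes \<alpha>: "\<alpha> > -1" and x: "x \<noteq> 0"
  shows "0 < Lp_norm \<alpha> 2 (toeplitz_fun \<alpha> cut_symbol (const_ball x :: 'n::finite ell2_fun))"
proof (rule ccontr)
  let ?F = "toeplitz_fun \<alpha> cut_symbol (const_ball x :: 'n ell2_fun)"
  have const: "(const_ball x :: 'n ell2_fun) \<in> bergman_space \<alpha>"
    using const_in_bergman_space(1)[OF \<alpha>] by (simp add: const_ball_def)
  have F: "?F \<in> bergman_space \<alpha>" by (rule toeplitz_cut_bergman(1)[OF \<alpha> const])
  assume "\<not> 0 < Lp_norm \<alpha> 2 ?F"
  moreover have "0 \<le> (LINT z|nu \<alpha>. (norm (?F z))\<^sup>2)" by simp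
  ultimately have "(LINT z|nu \<alpha>. (norm (?F z))\<^sup>2) = 0" unfolding Lp_norm_2 by simp
  then have "AE z in nu \<alpha>. (norm (?F z))\<^sup>2 = 0"
    using integral_nonneg_eq_0_iff_AE[OF bergman_space_integrable_square[OF \<alpha> F]] by simp
  then have ae: "AE z in nu \<alpha>. z \<notin> {z \<in> ball 0 1. ?F z \<noteq> 0}"
    by eventually_elim simp
  have cont: "continuous_on (ball 0 1) ?F"
    using F by (simp add: bergman_space_def holomorphic_ball_imp_continuous_on)
  have "{z \<in> ball 0 1. ?F z \<noteq> 0} = ball 0 1 \<inter> ?F -` (- {0})" by auto
  then have "open {z \<in> ball 0 1. ?F z \<noteq> 0}"
    using continuous_open_preimage[OF cont open_ball open_Compl[OF closed_singleton]] by simp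
  then have "{z \<in> ball 0 1. ?F z \<noteq> 0} = {}"
    by (rule AE_nu_open_imp_empty[OF \<alpha> _ _ ae]) auto
  then have "?F 0 = 0" by auto
  moreover have "?F 0 = complex_of_real (measure (nu \<alpha>) (ball (0 :: complex ^ 'n) (1/2))) *\<^sub>C x"
  proof -
    interpret finite_measure "nu \<alpha> :: (complex ^ 'n) measure" by (rule finite_measure_nu[OF \<alpha>])
    have "hdot 0 w = 0" for w :: "complex ^ 'n" by (simp add: hdot_def)
    moreover have "ball 0 (1/2) \<inter> ball (0 :: complex ^ 'n) 1 = ball 0 (1/2)" by auto
    moreover have "(LINT w|nu \<alpha>. indicator (ball (0 :: complex ^ 'n) (1/2)) w)
        = (LINT w|nu \<alpha>. complex_of_real (indicator (ball (0 :: complex ^ 'n) (1/2)) w))"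
      by (rule Bochner_Integration.integral_cong) (auto simp: indicator_def)
    ultimately show ?thesis
      by (simp add: toeplitz_cut_const_ball[OF \<alpha>] ker_deriv_def)
  qed
  ultimately have "cmod (complex_of_real (measure (nu \<alpha>) (ball (0 :: complex ^ 'n) (1/2)))) * norm x = 0"
    by (metis norm_scaleC norm_zero)
  then have "measure (nu \<alpha>) (ball (0 :: complex ^ 'n) (1/2)) = 0" using x by simp
  then have "emeasure (nu \<alpha>) (ball (0 :: complex ^ 'n) (1/2)) = 0"
    by (simp add: finite_measure.emeasure_eq_measure[OF finite_measure_nu[OF \<alpha>]])
  then have "ball (0 :: complex ^ 'n) (1/2) \<in> null_sets (nu \<alpha>)"
    by (intro null_setsI sub_ball_in_sets_nu)
  then have "AE z in nu \<alpha>. z \<notin> ball (0 :: complex ^ 'n) (1/2)" by (rule AE_not_in)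
  then have "ball (0 :: complex ^ 'n) (1/2) = {}"
    by (rule AE_nu_open_imp_empty[OF \<alpha> open_ball, rotated]) auto
  then show False by simp
qed

text \<open>An approximant \<open>S\<close> closer than \<delta> is refuted by a constant
  \<open>e N\<close> that it annihilates: this is an admissible test function, and the difference
  has norm \<delta> on it.\<close>

lemma toeplitz_cut_not_in_toeplitz_algebra:
  assumes \<alpha>: "\<alpha> > -1" and e: "ell2_orthonormal_basis e"
  shows "(toeplitz_fun \<alpha> cut_symbol :: 'n::finite ell2_fun \<Rightarrow> 'n ell2_fun) \<notin> toeplitz_algebra \<alpha> e"
proof
  let ?T = "toeplitz_fun \<alpha> cut_symbol :: 'n ell2_fun \<Rightarrow> 'n ell2_fun"
  define \<delta> where "\<delta> = Lp_norm \<alpha> 2 (?T (const_ball (e 0)))"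
  have const: "(const_ball (e N) :: 'n ell2_fun) \<in> bergman_space \<alpha>"
    "Lp_norm \<alpha> 2 (const_ball (e N) :: 'n ell2_fun) \<le> 1" for N
    using const_in_bergman_space[OF \<alpha>, where x = "e N" and 'n = 'n] orthonormal_basis_norm[OF e]
    by (simp_all add: const_ball_def)
  have "e 0 \<noteq> 0" using orthonormal_basis_norm[OF e, of 0] by auto
  then have "0 < \<delta>" unfolding \<delta>_def by (rule Lp_norm_toeplitz_cut_const_ball_pos[OF \<alpha>])
  assume "?T \<in> toeplitz_algebra \<alpha> e"
  then obtain S where S: "S \<in> toeplitz_poly \<alpha> e"
    and lt: "bergman_op_norm \<alpha> (\<lambda>f z. ?T f z - S f z) < \<delta>"
    using \<open>0 < \<delta>\<close> unfolding toeplitz_algebra_def by blast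
  obtain N where N: "S (const_ball (e N)) = (\<lambda>z. 0)"
    using toeplitz_poly_const_ball_zero[OF \<alpha> e S] by blast
  have "norm (?T (const_ball (e N)) z) = norm (?T (const_ball (e 0)) z)" for z
  proof (cases "norm z < 1")
    case True
    then show ?thesis
      by (simp add: toeplitz_cut_const_ball[OF \<alpha>] norm_scaleC orthonormal_basis_norm[OF e])
  qed (simp add: toeplitz_fun_def)
  then have "\<delta> = Lp_norm \<alpha> 2 (\<lambda>z. ?T (const_ball (e N)) z - S (const_ball (e N)) z)"
    unfolding \<delta>_def N Lp_norm_2 by simp
  also have "\<dots> \<le> bergman_op_norm \<alpha> (\<lambda>f z. ?T f z - S f z)"
    unfolding bergman_op_norm_def
  proof (rule cSUP_upper)
    show "(const_ball (e N) :: 'n ell2_fun) \<in> {f \<in> bergman_space \<alpha>. Lp_norm \<alpha> 2 f \<le> 1}"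
      using const by simp
    obtain C where C: "C \<ge> 0" "\<forall>f\<in>bergman_space \<alpha>. ?T f \<in> bergman_space \<alpha> \<and> Lp_norm \<alpha> 2 (?T f) \<le> C * Lp_norm \<alpha> 2 f"
      using bergman_op_imp_bounded[OF bergman_op_toeplitz_cut[OF \<alpha>]] unfolding bergman_bounded_def by blast
    obtain D where D: "D \<ge> 0" "\<forall>f\<in>bergman_space \<alpha>. S f \<in> bergman_space \<alpha> \<and> Lp_norm \<alpha> 2 (S f) \<le> D * Lp_norm \<alpha> 2 f"
      using bergman_bounded_toeplitz_poly[OF \<alpha> S] unfolding bergman_bounded_def by blast
    \<comment> \<open>A real supremum bounds its members only when the set is bounded above; the
      bounds for both operators supply this.\<close>
    show "bdd_above ((\<lambda>f. Lp_norm \<alpha> 2 (\<lambda>z. ?T f z - S f z)) ` {f \<in> bergman_space \<alpha>. Lp_norm \<alpha> 2 f \<le> 1})"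
    proof (rule bdd_aboveI2)
      fix f :: "'n ell2_fun" assume f: "f \<in> {f \<in> bergman_space \<alpha>. Lp_norm \<alpha> 2 f \<le> 1}"
      then have TS: "?T f \<in> bergman_space \<alpha>" "S f \<in> bergman_space \<alpha>" using C D by auto
      have "Lp_norm \<alpha> 2 (\<lambda>z. ?T f z - S f z) \<le> 2 * (Lp_norm \<alpha> 2 (?T f) + Lp_norm \<alpha> 2 (S f))"
        by (intro Lp_norm_2_le_if_norm_le_add bergman_space_integrable_square[OF \<alpha>] TS norm_triangle_ineq4)
      also have "\<dots> \<le> 2 * (C * Lp_norm \<alpha> 2 f + D * Lp_norm \<alpha> 2 f)"
        using C(2) D(2) f by (intro mult_left_mono add_mono) auto
      also have "\<dots> \<le> 2 * (C * 1 + D * 1)"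
        using C(1) D(1) f by (intro mult_left_mono add_mono) auto
      finally show "Lp_norm \<alpha> 2 (\<lambda>z. ?T f z - S f z) \<le> 2 * (C * 1 + D * 1)" .
    qed
  qed
  finally show False using lt by simp
qed

theorem theorem9p1:
  fixes \<alpha> :: real and e :: "nat \<Rightarrow> ell2"
  assumes "\<alpha> > -1" and "ell2_orthonormal_basis e"
  shows "\<exists>b :: complex ^ 'n \<Rightarrow> ell2 \<Rightarrow>\<^sub>L ell2.
    (\<forall>z\<in>ball 0 1. b z \<in> L_ell2) \<and> b \<in> BMO1 \<alpha> \<and> berezin \<alpha> b \<in> Linf_space \<alpha> \<and>
    (\<exists>T. is_toeplitz_op \<alpha> b T \<and> T \<notin> toeplitz_algebra \<alpha> e)"
proof (intro exI[of _ cut_symbol] exI[of _ "toeplitz_fun \<alpha> cut_symbol"] conjI ballI)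
  \<comment> \<open>The integral formula is itself the bounded extension, so agreement on
    \<open>Hinf_space\<close> is reflexivity.\<close>
  show "is_toeplitz_op \<alpha> cut_symbol (toeplitz_fun \<alpha> cut_symbol :: 'n ell2_fun \<Rightarrow> _)"
    unfolding is_toeplitz_op_def using bergman_op_toeplitz_cut[OF assms(1)] by blast
qed (rule cut_symbol_L_ell2 cut_symbol_BMO1 berezin_cut_symbol_Linf
    toeplitz_cut_not_in_toeplitz_algebra assms)+

end
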